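(* Let (S) denote the Hamiltonian system $$\frac{dx}{dt}=\frac{\partial H}{\partial y},\quad \frac{dy}{dt}=-\frac{\partial H}{\partial x},\quad \frac{dz}{dt}=\frac{\partial H}{\partial w},\quad \frac{dw}{dt}=-\frac{\partial H}{\partial z}$$ with polynomial Hamiltonian $$H=H_{VI}(x,y,t;\alpha_0,\alpha_1,\alpha_2,\alpha_3,\alpha_4)+H_{VI}(z,w,t;\beta_0,\beta_1,\beta_2,\beta_3,\beta_4)+\frac{2(x-t)yz\{(z-1)w+\beta_2\}}{t(t-1)}$$ and parameters as described in the context. Then (S) admits extended affine Weyl group symmetry of type $D_6^{(1)}$ as the group of its Bäcklund transformations, whose generators $s_0,\dots,s_6,\pi_1,\dots,\pi_4$ are given as follows, with $( * )=(x,y,z,w,t;\alpha_0,\alpha_1,\alpha_2,\gamma_1,\beta_2,\beta_3,\beta_4)$: \begin{align*} s_0:( * )&\to\left(x,y-\tfrac{\alpha_0}{x-t},z,w,t;-\alpha_0,\alpha_1,\alpha_2+\alpha_0,\gamma_1,\beta_2,\beta_3,\beta_4\right),\\ s_1:( * )&\to(x,y,z,w,t;\alpha_0,-\alpha_1,\alpha_2+\alpha_1,\gamma_1,\beta_2,\beta_3,\beta_4),\\ s_2:( * )&\to\left(x+\tfrac{\alpha_2}{y},y,z,w,t;\alpha_0+\alpha_2,\alpha_1+\alpha_2,-\alpha_2,\gamma_1+\alpha_2,\beta_2,\beta_3,\beta_4\right),\\ s_3:( * )&\to\left(x,y-\tfrac{\gamma_1}{x-z},z,w+\tfrac{\gamma_1}{x-z},t;\alpha_0,\alpha_1,\alpha_2+\gamma_1,-\gamma_1,\beta_2+\gamma_1,\beta_3,\beta_4\right),\\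 s_4:( * )&\to\left(x,y,z+\tfrac{\beta_2}{w},w,t;\alpha_0,\alpha_1,\alpha_2,\gamma_1+\beta_2,-\beta_2,\beta_3+\beta_2,\beta_4+\beta_2\right),\\ s_5:( * )&\to\left(x,y,z,w-\tfrac{\beta_3}{z-1},t;\alpha_0,\alpha_1,\alpha_2,\gamma_1,\beta_2+\beta_3,-\beta_3,\beta_4\right),\\ s_6:( * )&\to\left(x,y,z,w-\tfrac{\beta_4}{z},t;\alpha_0,\alpha_1,\alpha_2,\gamma_1,\beta_2+\beta_4,\beta_3,-\beta_4\right),\\ \pi_1:( * )&\to\Big(\tfrac{t(t-1)+t(x-t)}{x-t},-\tfrac{(x-t)((x-t)y+\alpha_2)}{t(t-1)},\tfrac{t(t-1)+t(z-t)}{z-t},-\tfrac{(z-t)((z-t)w+\beta_2)}{t(t-1)},t;\\ &\qquad\alpha_1,\alpha_0,\alpha_2,\gamma_1,\beta_2,\beta_4,\beta_3\Big),\\ \pi_2:( * )&\to\left(\tfrac{t}{z},-\tfrac{z(zw+\beta_2)}{t},\tfrac{t}{x},-\tfrac{x(xy+\alpha_2)}{t},t;\beta_3,\beta_4,\beta_2,\gamma_1,\alpha_2,\alpha_0,\alpha_1\right),\\ \pi_3:( * )&\to(1-x,-y,1-z,-w,1-t;\alpha_0,\alpha_1,\alpha_2,\gamma_1,\beta_2,\beta_4,\beta_3),\\ \pi_4:( * )&\to\Big(\tfrac{(t-1)x}{t-x},\tfrac{(t-x)(ty-xy-\alpha_2)}{t(t-1)},\tfrac{(t-1)z}{t-z},\tfrac{(t-z)(tw-zw-\beta_2)}{t(t-1)},1-t;\\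 &\qquad\alpha_1,\alpha_0,\alpha_2,\gamma_1,\beta_2,\beta_3,\beta_4\Big). \end{align*}
   Context: For $\delta_0+\delta_1+2\delta_2+\delta_3+\delta_4=1$, $$H_{VI}(q,p,t;\delta_0,\dots,\delta_4)=\tfrac{1}{t(t-1)}\big[p^2(q-t)(q-1)q-\{(\delta_0-1)(q-1)q+\delta_3(q-t)q+\delta_4(q-t)(q-1)\}p+\delta_2(\delta_1+\delta_2)q\big].$$ The free parameters are complex numbers $\alpha_0,\alpha_1,\alpha_2,\gamma_1,\beta_2,\beta_3,\beta_4$ with $\alpha_0+\alpha_1+2\alpha_2+2\gamma_1+2\beta_2+\beta_3+\beta_4=1$, where $\gamma_1:=\alpha_4-\beta_4$; the other parameters are determined by $\alpha_4=\gamma_1+\beta_4$, $\alpha_3=\gamma_1+2\beta_2+\beta_3$, $\beta_0=\alpha_0+\gamma_1$, $\beta_1=\alpha_1+2\alpha_2+\gamma_1$. A Bäcklund transformation is a birational change of $(x,y,z,w,t)$ (depending on the parameters) together with a change of parameters that carries the system with the old parameters into the system with the new parameters (in the new variables, with the new independent variable). Transformations are composed as substitution automorphisms of the field of rational functions in $x,y,z,w,t$ and the parameters. "Extended affine Weyl group symmetry of type $D_6^{(1)}$" means: all the transformations are Bäcklund transformations; $s_i^2=1$ and $(s_is_j)^{m_{ij}}=1$ with $m_{ij}=3$ if $\{i,j\}\in\{\{0,2\},\{1,2\},\{2,3\},\{3,4\},\{4,5\},\{4,6\}\}$ and $m_{ij}=2$ for other $i\ne j$ (Dynkin diagram of type $D_6^{(1)}$);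 and the $\pi_j$ act as diagram automorphisms: they are involutions permuting the $s_i$ by conjugation, via $\pi_1$: $0\leftrightarrow1,\ 5\leftrightarrow6$; $\pi_2$: $0\leftrightarrow5,\ 1\leftrightarrow6,\ 2\leftrightarrow4$; $\pi_3$: $5\leftrightarrow6$; $\pi_4$: $0\leftrightarrow1$. *)

theory Defs
  imports
    "HOL-Analysis.Analysis"
    "HOL-Library.Poly_Mapping"
    "HOL-Computational_Algebra.Fraction_Field"
begin

section \<open>Points and the Hamiltonian\<close>

datatype 'a params =
  Params (par_a0: 'a) (par_a1: 'a) (par_a2: 'a) (par_g1: 'a) (par_b2: 'a) (par_b3: 'a) (par_b4: 'a)

datatype 'a pt =
  Pt (pt_x: 'a) (pt_y: 'a) (pt_z: 'a) (pt_w: 'a) (pt_t: 'a) (pt_params: "'a params")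

fun normalised :: "'a::field params \<Rightarrow> bool" where
  "normalised (Params a0 a1 a2 g1 b2 b3 b4) \<longleftrightarrow> a0 + a1 + 2*a2 + 2*g1 + 2*b2 + b3 + b4 = 1"

definition H_VI :: "'a::field \<Rightarrow> 'a \<Rightarrow> 'a \<Rightarrow> 'a \<Rightarrow> 'a \<Rightarrow> 'a \<Rightarrow> 'a \<Rightarrow> 'a \<Rightarrow> 'a" where
  "H_VI q p t d0 d1 d2 d3 d4 =
     1 / (t*(t - 1)) *
       (p^2 * (q - t) * (q - 1) * q
        - ((d0 - 1) * (q - 1) * q + d3 * (q - t) * q + d4 * (q - t) * (q - 1)) * p
        + d2 * (d1 + d2) * q)"

fun Ham :: "'a::field pt \<Rightarrow> 'a" where
  "Ham (Pt x y z w t (Params a0 a1 a2 g1 b2 b3 b4)) =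
     (let a4 = g1 + b4; a3 = g1 + 2*b2 + b3; b0 = a0 + g1; b1 = a1 + 2*a2 + g1
      in H_VI x y t a0 a1 a2 a3 a4 + H_VI z w t b0 b1 b2 b3 b4
         + 2 * (x - t) * y * z * ((z - 1) * w + b2) / (t*(t - 1)))"

fun Ham_x :: "complex pt \<Rightarrow> complex" where
  "Ham_x (Pt x y z w t \<theta>) = deriv (\<lambda>\<xi>. Ham (Pt \<xi> y z w t \<theta>)) x"
fun Ham_y :: "complex pt \<Rightarrow> complex" where
  "Ham_y (Pt x y z w t \<theta>) = deriv (\<lambda>\<xi>. Ham (Pt x \<xi> z w t \<theta>)) y"
fun Ham_z :: "complex pt \<Rightarrow> complex" where
  "Ham_z (Pt x y z w t \<theta>) = deriv (\<lambda>\<xi>. Ham (Pt x y \<xi> w t \<theta>)) z"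
fun Ham_w :: "complex pt \<Rightarrow> complex" where
  "Ham_w (Pt x y z w t \<theta>) = deriv (\<lambda>\<xi>. Ham (Pt x y z \<xi> t \<theta>)) w"

text \<open>
  A curve \<open>C\<close> over \<open>U\<close> is a solution of (S), with the independent variable given by its
  own \<open>t\<close>-component: the factor \<open>t'\<close> turns \<open>d/ds\<close> into \<open>d/dt\<close>, so that for instance
  \<open>(dx/ds)/(dt/ds) = Ham_y\<close>. If the \<open>t\<close>-component of \<open>C s\<close> is \<open>s\<close>, then \<open>t' = 1\<close> and this is
  literally the system (S) for \<open>x\<close>, \<open>y\<close>, \<open>z\<close>, \<open>w\<close> as functions of \<open>s\<close>.
\<close>

definition solution_curve :: "complex set \<Rightarrow> (complex \<Rightarrow> complex pt) \<Rightarrow> bool" where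
  "solution_curve U C \<longleftrightarrow>
     open U \<and> (\<exists>\<theta>. normalised \<theta> \<and> (\<forall>s\<in>U. pt_params (C s) = \<theta>)) \<and>
     (\<forall>s\<in>U. pt_t (C s) \<noteq> 0 \<and> pt_t (C s) \<noteq> 1 \<and>
        (\<exists>t'. t' \<noteq> 0 \<and>
           ((\<lambda>s. pt_t (C s)) has_field_derivative t') (at s) \<and>
           ((\<lambda>s. pt_x (C s)) has_field_derivative t' * Ham_y (C s)) (at s) \<and>
           ((\<lambda>s. pt_y (C s)) has_field_derivative t' * (- Ham_x (C s))) (at s) \<and>
           ((\<lambda>s. pt_z (C s)) has_field_derivative t' * Ham_w (C s)) (at s) \<and>
           ((\<lambda>s. pt_w (C s)) has_field_derivative t' * (- Ham_z (C s))) (at s)))"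


section \<open>The field of rational functions\<close>

text \<open>
  The rational functions in the variables and the parameters form the function field of the
  hyperplane \<open>\<alpha>\<^sub>0 + \<alpha>\<^sub>1 + 2\<alpha>\<^sub>2 + 2\<gamma>\<^sub>1 + 2\<beta>\<^sub>2 + \<beta>\<^sub>3 + \<beta>\<^sub>4 = 1\<close>. We take the eleven coordinates
  other than \<open>\<alpha>\<^sub>0\<close> as independent generators and let the relation define \<open>\<alpha>\<^sub>0\<close>. The linear order
  on the coordinates has no meaning beyond making the polynomial ring an instance of
  \<open>idom\<close>.
\<close>

datatype coord = Cx | Cy | Cz | Cw | Ct | Ca1 | Ca2 | Cg1 | Cb2 | Cb3 | Cb4

fun coord_rank :: "coord \<Rightarrow> nat" where
  "coord_rank Cx = 0" | "coord_rank Cy = 1" | "coord_rank Cz = 2" | "coord_rank Cw = 3"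
| "coord_rank Ct = 4" | "coord_rank Ca1 = 5" | "coord_rank Ca2 = 6" | "coord_rank Cg1 = 7"
| "coord_rank Cb2 = 8" | "coord_rank Cb3 = 9" | "coord_rank Cb4 = 10"

lemma coord_rank_inject: "coord_rank u = coord_rank v \<longleftrightarrow> u = v"
  by (cases u; cases v) simp_all

instantiation coord :: linorder
begin

definition less_eq_coord :: "coord \<Rightarrow> coord \<Rightarrow> bool" where
  "less_eq_coord u v \<longleftrightarrow> coord_rank u \<le> coord_rank v"

definition less_coord :: "coord \<Rightarrow> coord \<Rightarrow> bool" where
  "less_coord u v \<longleftrightarrow> coord_rank u < coord_rank v"

instance
  by standard (auto simp: less_eq_coord_def less_coord_def coord_rank_inject)

end

type_synonym cpoly = "(coord \<Rightarrow>\<^sub>0 nat) \<Rightarrow>\<^sub>0 complex"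
type_synonym ratfun = "cpoly fract"

definition const :: "complex \<Rightarrow> ratfun" where
  "const c = Fract (Poly_Mapping.single 0 c) 1"

definition gen :: "coord \<Rightarrow> ratfun" where
  "gen v = Fract (Poly_Mapping.single (Poly_Mapping.single v 1) 1) 1"

definition generic :: "ratfun pt" where
  "generic = Pt (gen Cx) (gen Cy) (gen Cz) (gen Cw) (gen Ct)
     (Params (1 - gen Ca1 - 2 * gen Ca2 - 2 * gen Cg1 - 2 * gen Cb2 - gen Cb3 - gen Cb4)
        (gen Ca1) (gen Ca2) (gen Cg1) (gen Cb2) (gen Cb3) (gen Cb4))"

fun coord_of :: "'a pt \<Rightarrow> coord \<Rightarrow> 'a" where
  "coord_of (Pt x y z w t (Params a0 a1 a2 g1 b2 b3 b4)) v =
     (case v of Cx \<Rightarrow> x | Cy \<Rightarrow> y | Cz \<Rightarrow> z | Cw \<Rightarrow> w | Ct \<Rightarrow> t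
        | Ca1 \<Rightarrow> a1 | Ca2 \<Rightarrow> a2 | Cg1 \<Rightarrow> g1 | Cb2 \<Rightarrow> b2 | Cb3 \<Rightarrow> b3 | Cb4 \<Rightarrow> b4)"

text \<open>
  Evaluation at a point with coordinates in a field \<open>'a\<close> into which the complex numbers are
  embedded by \<open>\<kappa>\<close>. A rational function is regular at the point if it has a representation
  whose denominator does not vanish there; only then is its value meaningful.
\<close>

definition poly_value :: "(complex \<Rightarrow> 'a::field) \<Rightarrow> 'a pt \<Rightarrow> cpoly \<Rightarrow> 'a" where
  "poly_value \<kappa> P p =
     (\<Sum>m\<in>Poly_Mapping.keys p. \<kappa> (Poly_Mapping.lookup p m) *
        (\<Prod>v\<in>Poly_Mapping.keys m. coord_of P v ^ Poly_Mapping.lookup m v))"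

definition regular_at :: "(complex \<Rightarrow> 'a::field) \<Rightarrow> 'a pt \<Rightarrow> ratfun \<Rightarrow> bool" where
  "regular_at \<kappa> P f \<longleftrightarrow> (\<exists>p q. f = Fract p q \<and> poly_value \<kappa> P q \<noteq> 0)"

definition rat_value :: "(complex \<Rightarrow> 'a::field) \<Rightarrow> 'a pt \<Rightarrow> ratfun \<Rightarrow> 'a" where
  "rat_value \<kappa> P f =
     (THE r. \<exists>p q. f = Fract p q \<and> poly_value \<kappa> P q \<noteq> 0 \<and>
        r = poly_value \<kappa> P p / poly_value \<kappa> P q)"

definition subst :: "ratfun pt \<Rightarrow> ratfun \<Rightarrow> ratfun" where
  "subst P = rat_value const P"

definition param_poly :: "cpoly \<Rightarrow> bool" where
  "param_poly p \<longleftrightarrow>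
     (\<forall>m\<in>Poly_Mapping.keys p. Poly_Mapping.keys m \<subseteq> {Ca1, Ca2, Cg1, Cb2, Cb3, Cb4})"

definition param_field :: "ratfun set" where
  "param_field = {Fract p q | p q. param_poly p \<and> param_poly q \<and> q \<noteq> 0}"


section \<open>Baecklund transformations\<close>

definition field_automorphism :: "(ratfun \<Rightarrow> ratfun) \<Rightarrow> bool" where
  "field_automorphism \<phi> \<longleftrightarrow> bij \<phi> \<and>
     (\<forall>f g. \<phi> (f + g) = \<phi> f + \<phi> g) \<and> (\<forall>f g. \<phi> (f * g) = \<phi> f * \<phi> g) \<and>
     (\<forall>c. \<phi> (const c) = const c)"

definition transform_curve ::
    "(ratfun \<Rightarrow> ratfun) \<Rightarrow> (complex \<Rightarrow> complex pt) \<Rightarrow> complex \<Rightarrow> complex pt" where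
  "transform_curve \<phi> C s = map_pt (\<lambda>f. rat_value id (C s) (\<phi> f)) generic"

text \<open>
  The old system is carried into the new one: wherever the transformed coordinates are
  defined along a solution of (S) with independent variable \<open>s = t\<close>, they solve (S) for the
  transformed parameters and with respect to the transformed \<open>t\<close>.
\<close>

definition carries_system :: "(ratfun \<Rightarrow> ratfun) \<Rightarrow> bool" where
  "carries_system \<phi> \<longleftrightarrow>
     (\<forall>U C. solution_curve U C \<and> (\<forall>s\<in>U. pt_t (C s) = s) \<and>
        (\<forall>s\<in>U. \<forall>f\<in>set_pt generic. regular_at id (C s) (\<phi> f)) \<longrightarrow>
        solution_curve U (transform_curve \<phi> C))"

text \<open>
  A birational change of the variables depending on the parameters, together with a change
  of the parameters alone, is an automorphism of the field of rational functions over the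
  complex numbers that maps the subfield of functions of the parameters onto itself.
\<close>

definition baecklund :: "(ratfun \<Rightarrow> ratfun) \<Rightarrow> bool" where
  "baecklund \<phi> \<longleftrightarrow>
     field_automorphism \<phi> \<and> \<phi> ` param_field = param_field \<and> carries_system \<phi>"


section \<open>The generators\<close>

fun s0_map :: "'a::field pt \<Rightarrow> 'a pt" where
  "s0_map (Pt x y z w t (Params a0 a1 a2 g1 b2 b3 b4)) =
     Pt x (y - a0 / (x - t)) z w t (Params (- a0) a1 (a2 + a0) g1 b2 b3 b4)"

fun s1_map :: "'a::field pt \<Rightarrow> 'a pt" where
  "s1_map (Pt x y z w t (Params a0 a1 a2 g1 b2 b3 b4)) =
     Pt x y z w t (Params a0 (- a1) (a2 + a1) g1 b2 b3 b4)"

fun s2_map :: "'a::field pt \<Rightarrow> 'a pt" where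
  "s2_map (Pt x y z w t (Params a0 a1 a2 g1 b2 b3 b4)) =
     Pt (x + a2 / y) y z w t (Params (a0 + a2) (a1 + a2) (- a2) (g1 + a2) b2 b3 b4)"

fun s3_map :: "'a::field pt \<Rightarrow> 'a pt" where
  "s3_map (Pt x y z w t (Params a0 a1 a2 g1 b2 b3 b4)) =
     Pt x (y - g1 / (x - z)) z (w + g1 / (x - z)) t
       (Params a0 a1 (a2 + g1) (- g1) (b2 + g1) b3 b4)"

fun s4_map :: "'a::field pt \<Rightarrow> 'a pt" where
  "s4_map (Pt x y z w t (Params a0 a1 a2 g1 b2 b3 b4)) =
     Pt x y (z + b2 / w) w t (Params a0 a1 a2 (g1 + b2) (- b2) (b3 + b2) (b4 + b2))"

fun s5_map :: "'a::field pt \<Rightarrow> 'a pt" where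
  "s5_map (Pt x y z w t (Params a0 a1 a2 g1 b2 b3 b4)) =
     Pt x y z (w - b3 / (z - 1)) t (Params a0 a1 a2 g1 (b2 + b3) (- b3) b4)"

fun s6_map :: "'a::field pt \<Rightarrow> 'a pt" where
  "s6_map (Pt x y z w t (Params a0 a1 a2 g1 b2 b3 b4)) =
     Pt x y z (w - b4 / z) t (Params a0 a1 a2 g1 (b2 + b4) b3 (- b4))"

fun pi1_map :: "'a::field pt \<Rightarrow> 'a pt" where
  "pi1_map (Pt x y z w t (Params a0 a1 a2 g1 b2 b3 b4)) =
     Pt ((t * (t - 1) + t * (x - t)) / (x - t))
        (- ((x - t) * ((x - t) * y + a2) / (t * (t - 1))))
        ((t * (t - 1) + t * (z - t)) / (z - t))
        (- ((z - t) * ((z - t) * w + b2) / (t * (t - 1))))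
        t (Params a1 a0 a2 g1 b2 b4 b3)"

fun pi2_map :: "'a::field pt \<Rightarrow> 'a pt" where
  "pi2_map (Pt x y z w t (Params a0 a1 a2 g1 b2 b3 b4)) =
     Pt (t / z) (- (z * (z * w + b2) / t)) (t / x) (- (x * (x * y + a2) / t))
        t (Params b3 b4 b2 g1 a2 a0 a1)"

fun pi3_map :: "'a::field pt \<Rightarrow> 'a pt" where
  "pi3_map (Pt x y z w t (Params a0 a1 a2 g1 b2 b3 b4)) =
     Pt (1 - x) (- y) (1 - z) (- w) (1 - t) (Params a0 a1 a2 g1 b2 b4 b3)"

fun pi4_map :: "'a::field pt \<Rightarrow> 'a pt" where
  "pi4_map (Pt x y z w t (Params a0 a1 a2 g1 b2 b3 b4)) =
     Pt ((t - 1) * x / (t - x)) ((t - x) * (t * y - x * y - a2) / (t * (t - 1)))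
        ((t - 1) * z / (t - z)) ((t - z) * (t * w - z * w - b2) / (t * (t - 1)))
        (1 - t) (Params a1 a0 a2 g1 b2 b3 b4)"

definition s_map :: "nat \<Rightarrow> 'a::field pt \<Rightarrow> 'a pt" where
  "s_map i = [s0_map, s1_map, s2_map, s3_map, s4_map, s5_map, s6_map] ! i"

definition pi_map :: "nat \<Rightarrow> 'a::field pt \<Rightarrow> 'a pt" where
  "pi_map j = [pi1_map, pi2_map, pi3_map, pi4_map] ! (j - 1)"

definition s_aut :: "nat \<Rightarrow> ratfun \<Rightarrow> ratfun" where
  "s_aut i = subst (s_map i generic)"

definition pi_aut :: "nat \<Rightarrow> ratfun \<Rightarrow> ratfun" where
  "pi_aut j = subst (pi_map j generic)"


section \<open>The diagram of type \<open>D\<^sub>6\<^sup>(\<^sup>1\<^sup>)\<close>\<close>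

definition D6_edges :: "nat set set" where
  "D6_edges = {{0,2}, {1,2}, {2,3}, {3,4}, {4,5}, {4,6}}"

definition D6_m :: "nat \<Rightarrow> nat \<Rightarrow> nat" where
  "D6_m i j = (if {i, j} \<in> D6_edges then 3 else 2)"

definition D6_sigma :: "nat \<Rightarrow> nat \<Rightarrow> nat" where
  "D6_sigma j =
     [id(0 := 1, 1 := 0, 5 := 6, 6 := 5),
      id(0 := 5, 5 := 0, 1 := 6, 6 := 1, 2 := 4, 4 := 2),
      id(5 := 6, 6 := 5),
      id(0 := 1, 1 := 0)] ! (j - 1)"

end

(*
  The generators are given by formulas over an arbitrary field, so the same formulas act on
  the generic point and on complex points. Each of them is an involution wherever it is defined,
  which makes substitution an automorphism of the function field, and an automorphism is determined
  by the image of the generic point. Hence the relations of the group are identities between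
  rational maps; the braid relations all come from one identity for the pair of maps
  v -> v - a/u and u -> u + b/v.

  For the Hamiltonian system, the transformed coordinates along a solution can be regular only
  where the denominators of the generators do not vanish, and there the chain rule reduces the claim
  to identities of rational functions, given the normalisation of the parameters.
*)

theory Submission
  imports Defs
begin


section \<open>Evaluation of rational functions\<close>

text \<open>The obstacle is division. \<open>subst\<close> is built on \<open>rat_value\<close>, a
  definite description that says something only if some representation has a denominator not
  vanishing at the point, so substitution is a homomorphism only once the substituted coordinates
  are known to satisfy no polynomial relation. That the generators are involutions replaces any
  argument on algebraic independence: evaluating twice returns the original polynomial, which
  therefore cannot have evaluated to zero. Division in HOL is moreover total, so the identities
  between the maps are valid only where \<open>s_dom\<close> and \<open>pi_dom\<close> hold. At the
  images of the generic point under the generators these conditions need no computation, because an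
  automorphism is injective. At complex points they have to be won from regularity, and there a
  special value of a parameter can make a numerator vanish together with its denominator. This is
  harmless since the parameters are themselves variables of the function field and can be
  moved.\<close>

lemma UNIV_coord: "UNIV = {Cx, Cy, Cz, Cw, Ct, Ca1, Ca2, Cg1, Cb2, Cb3, Cb4}"
proof -
  have "v \<in> {Cx, Cy, Cz, Cw, Ct, Ca1, Ca2, Cg1, Cb2, Cb3, Cb4}" for v :: coord
    by (cases v) simp_all
  then show ?thesis by blast
qed

lemma finite_coord: "finite (A :: coord set)"
  by (rule finite_subset[OF subset_UNIV]) (simp add: UNIV_coord)

text \<open>The product runs over all coordinates instead of the support of \<open>m\<close>, so
  that multiplicativity in the exponent holds factor by factor.\<close>

definition mono_value :: "'a::field pt \<Rightarrow> (coord \<Rightarrow>\<^sub>0 nat) \<Rightarrow> 'a" where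
  "mono_value P m = (\<Prod>v\<in>UNIV. coord_of P v ^ Poly_Mapping.lookup m v)"

lemma mono_value_keys:
  "(\<Prod>v\<in>Poly_Mapping.keys m. coord_of P v ^ Poly_Mapping.lookup m v) = mono_value P m"
  unfolding mono_value_def
  by (rule prod.mono_neutral_left) (auto simp: finite_coord in_keys_iff)

lemma mono_value_0: "mono_value P 0 = 1"
  by (simp add: mono_value_def)

lemma mono_value_add: "mono_value P (m + n) = mono_value P m * mono_value P n"
  by (simp add: mono_value_def lookup_add power_add prod.distrib)

lemma mono_value_single: "mono_value P (Poly_Mapping.single v 1) = coord_of P v"
proof -
  have "mono_value P (Poly_Mapping.single v 1) = (\<Prod>u\<in>{v}. coord_of P u ^ 1)"
    unfolding mono_value_def
    by (rule prod.mono_neutral_cong_right) (auto simp: finite_coord lookup_single)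
  then show ?thesis by simp
qed

lemma cpoly_sum_single:
  "(p :: cpoly) = (\<Sum>m\<in>Poly_Mapping.keys p. Poly_Mapping.single m (Poly_Mapping.lookup p m))"
  by (rule poly_mapping_eqI)
    (auto simp: lookup_sum lookup_single when_def in_keys_iff sum.delta)

lemma cpoly_induct [case_names add single]:
  assumes "\<And>p q :: cpoly. Q p \<Longrightarrow> Q q \<Longrightarrow> Q (p + q)"
    and "\<And>m c. Q (Poly_Mapping.single m c)"
  shows "Q p"
proof -
  have "Q 0" using assms(2)[of 0 0] by simp
  then have "Q (\<Sum>m\<in>A. Poly_Mapping.single m (Poly_Mapping.lookup p m))" for A
    using assms by (induction A rule: infinite_finite_induct) auto
  then show ?thesis using cpoly_sum_single[of p] by metis
qed

text \<open>There are two instances: \<open>id\<close> for evaluation at complex points and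
  \<open>const\<close> for substitution of rational functions. Partial evaluation is thus treated
  once for both.\<close>

locale evaluation =
  fixes \<kappa> :: "complex \<Rightarrow> 'a::field"
  assumes add: "\<kappa> (a + b) = \<kappa> a + \<kappa> b"
    and mult: "\<kappa> (a * b) = \<kappa> a * \<kappa> b"
    and one: "\<kappa> 1 = 1"
begin

lemma zero: "\<kappa> 0 = 0"
  using add[of 0 0] by (simp only: add_0_right add_cancel_right_right)

lemma poly_value_superset:
  assumes "finite A" and "Poly_Mapping.keys p \<subseteq> A"
  shows "poly_value \<kappa> P p = (\<Sum>m\<in>A. \<kappa> (Poly_Mapping.lookup p m) * mono_value P m)"
  unfolding poly_value_def mono_value_keys using assms
  by (intro sum.mono_neutral_left) (auto simp: in_keys_iff zero)

lemma poly_value_add: "poly_value \<kappa> P (p + q) = poly_value \<kappa> P p + poly_value \<kappa> P q"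
proof -
  let ?A = "Poly_Mapping.keys p \<union> Poly_Mapping.keys q"
  show ?thesis
    using keys_add[of p q]
    by (simp add: poly_value_superset[of ?A] lookup_add add distrib_right sum.distrib)
qed

lemma poly_value_single:
  "poly_value \<kappa> P (Poly_Mapping.single m c) = \<kappa> c * mono_value P m"
  by (subst poly_value_superset[of "{m}"]) auto

lemma poly_value_mult: "poly_value \<kappa> P (p * q) = poly_value \<kappa> P p * poly_value \<kappa> P q"
proof (induction p rule: cpoly_induct)
  case (single m c)
  show ?case
    by (induction q rule: cpoly_induct)
      (simp_all add: distrib_left poly_value_add mult_single poly_value_single mono_value_add mult)
qed (simp add: distrib_right poly_value_add)

lemma poly_value_0: "poly_value \<kappa> P 0 = 0"
  using poly_value_add[of P 0 0] by (simp only: add_0_right add_cancel_right_right)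

lemma poly_value_1: "poly_value \<kappa> P 1 = 1"
  by (simp add: poly_value_single one mono_value_0 flip: single_one)

lemma poly_value_uminus: "poly_value \<kappa> P (- p) = - poly_value \<kappa> P p"
  using poly_value_add[of P p "- p"] by (simp add: poly_value_0 eq_neg_iff_add_eq_0 add.commute)

end

text \<open>The graph of the partial map behind \<open>rat_value\<close>. Being regular and having a
  given value become one statement, which is closed under the field operations (division by a
  nonzero value) and lifts to points through \<open>rel_pt\<close>.\<close>

definition evals :: "(complex \<Rightarrow> 'a::field) \<Rightarrow> 'a pt \<Rightarrow> ratfun \<Rightarrow> 'a \<Rightarrow> bool" where
  "evals \<kappa> P f r \<longleftrightarrow> (\<exists>p q. f = Fract p q \<and> poly_value \<kappa> P q \<noteq> 0 \<and>
     r = poly_value \<kappa> P p / poly_value \<kappa> P q)"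

context evaluation
begin

lemma poly_value_nonzero: "poly_value \<kappa> P p \<noteq> 0 \<Longrightarrow> p \<noteq> 0"
  using poly_value_0 by blast

text \<open>Two representations of \<open>f\<close> satisfy \<open>p * q' = p' * q\<close>, and
  evaluation respects this polynomial identity. This is what makes the description in
  \<open>rat_value\<close> well defined.\<close>

lemma evals_unique:
  assumes "evals \<kappa> P f r" and "evals \<kappa> P f s"
  shows "r = s"
proof -
  obtain p q where f: "f = Fract p q" "poly_value \<kappa> P q \<noteq> 0"
    and r: "r = poly_value \<kappa> P p / poly_value \<kappa> P q"
    using assms(1) unfolding evals_def by blast
  obtain p' q' where f': "f = Fract p' q'" "poly_value \<kappa> P q' \<noteq> 0"
    and s: "s = poly_value \<kappa> P p' / poly_value \<kappa> P q'"
    using assms(2) unfolding evals_def by blast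
  have "p * q' = p' * q"
    using f f' poly_value_nonzero by (metis eq_fract(1))
  then have "poly_value \<kappa> P p * poly_value \<kappa> P q' = poly_value \<kappa> P p' * poly_value \<kappa> P q"
    by (metis poly_value_mult)
  then show ?thesis unfolding r s using f(2) f'(2) by (simp add: frac_eq_eq)
qed

lemma rat_value_eq: "evals \<kappa> P f r \<Longrightarrow> rat_value \<kappa> P f = r"
  unfolding rat_value_def evals_def[symmetric] using evals_unique by blast

lemma evals_Fract: "poly_value \<kappa> P q \<noteq> 0 \<Longrightarrow>
    evals \<kappa> P (Fract p q) (poly_value \<kappa> P p / poly_value \<kappa> P q)"
  unfolding evals_def by blast

lemma evals_poly: "evals \<kappa> P (Fract p 1) (poly_value \<kappa> P p)"
  using evals_Fract[of P 1 p] by (simp add: poly_value_1)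

lemma evals_const: "evals \<kappa> P (const c) (\<kappa> c)"
  using evals_poly[of P "Poly_Mapping.single 0 c"]
  by (simp add: const_def poly_value_single mono_value_0)

lemma evals_gen: "evals \<kappa> P (gen v) (coord_of P v)"
  using evals_poly[of P "Poly_Mapping.single (Poly_Mapping.single v 1) 1"]
  by (simp add: gen_def poly_value_single one mono_value_single del: One_nat_def)

lemma evals_one: "evals \<kappa> P 1 1"
  using evals_poly[of P 1] by (simp add: One_fract_def poly_value_1)

lemma evals_zero: "evals \<kappa> P 0 0"
  using evals_poly[of P 0] by (simp add: Zero_fract_def poly_value_0)

lemma evals_uminus: "evals \<kappa> P f r \<Longrightarrow> evals \<kappa> P (- f) (- r)"
  unfolding evals_def by (metis minus_fract poly_value_uminus minus_divide_left)

lemma evals_add: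
  assumes "evals \<kappa> P f r" and "evals \<kappa> P g s"
  shows "evals \<kappa> P (f + g) (r + s)"
proof -
  obtain p q where f: "f = Fract p q" "poly_value \<kappa> P q \<noteq> 0"
    "r = poly_value \<kappa> P p / poly_value \<kappa> P q"
    using assms(1) unfolding evals_def by blast
  obtain p' q' where g: "g = Fract p' q'" "poly_value \<kappa> P q' \<noteq> 0"
    "s = poly_value \<kappa> P p' / poly_value \<kappa> P q'"
    using assms(2) unfolding evals_def by blast
  have "evals \<kappa> P (Fract (p * q' + p' * q) (q * q')) (r + s)"
    using evals_Fract[of P "q * q'" "p * q' + p' * q"] f(2,3) g(2,3)
    by (simp add: poly_value_add poly_value_mult add_frac_eq)
  then show ?thesis
    using f(1,2) g(1,2) poly_value_nonzero by (metis add_fract)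
qed

lemma evals_diff: "evals \<kappa> P f r \<Longrightarrow> evals \<kappa> P g s \<Longrightarrow> evals \<kappa> P (f - g) (r - s)"
  using evals_add[of P f r "- g" "- s"] evals_uminus by simp

lemma evals_mult:
  assumes "evals \<kappa> P f r" and "evals \<kappa> P g s"
  shows "evals \<kappa> P (f * g) (r * s)"
proof -
  obtain p q where f: "f = Fract p q" "poly_value \<kappa> P q \<noteq> 0"
    "r = poly_value \<kappa> P p / poly_value \<kappa> P q"
    using assms(1) unfolding evals_def by blast
  obtain p' q' where g: "g = Fract p' q'" "poly_value \<kappa> P q' \<noteq> 0"
    "s = poly_value \<kappa> P p' / poly_value \<kappa> P q'"
    using assms(2) unfolding evals_def by blast
  show ?thesis
    using evals_Fract[of P "q * q'" "p * p'"] f g by (simp add: poly_value_mult)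
qed

lemma evals_inverse:
  assumes "evals \<kappa> P f r" and "r \<noteq> 0"
  shows "evals \<kappa> P (inverse f) (inverse r)"
proof -
  obtain p q where f: "f = Fract p q" "poly_value \<kappa> P q \<noteq> 0"
    "r = poly_value \<kappa> P p / poly_value \<kappa> P q"
    using assms(1) unfolding evals_def by blast
  then show ?thesis
    using evals_Fract[of P p q] assms(2) by simp
qed

lemma evals_divide:
  "evals \<kappa> P f r \<Longrightarrow> evals \<kappa> P g s \<Longrightarrow> s \<noteq> 0 \<Longrightarrow> evals \<kappa> P (f / g) (r / s)"
  by (simp add: divide_inverse evals_mult evals_inverse)

lemma evals_numeral: "evals \<kappa> P (numeral n) (numeral n)"
  by (induction n) (simp_all only: numeral.simps evals_one evals_add)

lemmas evals_intros = evals_gen evals_const evals_one evals_zero evals_numeral evals_uminus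
  evals_add evals_diff evals_mult evals_divide

end

interpretation complex_point: evaluation "id :: complex \<Rightarrow> complex"
  by standard simp_all

interpretation const: evaluation const
  by standard (simp_all add: const_def single_add mult_single One_fract_def)


section \<open>Substitutions\<close>

lemma coord_of_generic: "coord_of generic v = gen v"
  by (cases v) (simp_all add: generic_def)

lemma gen_power: "gen v ^ k = Fract (Poly_Mapping.single (Poly_Mapping.single v k) 1) 1"
  by (induction k) (simp_all add: One_fract_def gen_def mult_single flip: single_add)

lemma mono_value_generic: "mono_value generic m = Fract (Poly_Mapping.single m 1) 1"
proof -
  have "(\<Prod>v\<in>A. gen v ^ Poly_Mapping.lookup m v) =
      Fract (Poly_Mapping.single (\<Sum>v\<in>A. Poly_Mapping.single v (Poly_Mapping.lookup m v)) 1) 1"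
    if "finite A" for A
    using that by (induction A) (simp_all add: One_fract_def gen_power mult_single)
  moreover have "(\<Sum>v\<in>UNIV. Poly_Mapping.single v (Poly_Mapping.lookup m v)) = m"
    by (rule poly_mapping_eqI)
      (auto simp: lookup_sum lookup_single when_def sum.delta finite_coord)
  ultimately show ?thesis
    by (simp add: mono_value_def coord_of_generic finite_coord)
qed

text \<open>The generic point is tautological: putting the generators for the coordinates gives the
  polynomial back. Hence every rational function is a quotient of values at \<open>generic\<close>,
  and what is known about the generic point reaches the whole field.\<close>

lemma poly_value_generic: "poly_value const generic p = Fract p 1"
proof (induction p rule: cpoly_induct)
  case (single m c)
  show ?case
    by (simp add: const.poly_value_single mono_value_generic const_def[of c] mult_single)
qed (simp add: const.poly_value_add)

lemma Fract_eq_poly_value: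
  "q \<noteq> 0 \<Longrightarrow> Fract p q = poly_value const generic p / poly_value const generic q"
  by (simp add: poly_value_generic)

locale field_aut =
  fixes \<phi> :: "ratfun \<Rightarrow> ratfun"
  assumes aut: "field_automorphism \<phi>"
begin

lemma hom_add: "\<phi> (f + g) = \<phi> f + \<phi> g"
  and hom_mult: "\<phi> (f * g) = \<phi> f * \<phi> g"
  and hom_const: "\<phi> (const c) = const c"
  using aut unfolding field_automorphism_def by blast+

lemma hom_0: "\<phi> 0 = 0"
  using hom_add[of 0 0] by (simp only: add_0_right add_cancel_right_right)

lemma hom_1: "\<phi> 1 = 1"
  using hom_const[of 1] by (simp add: const.one)

lemma hom_uminus: "\<phi> (- f) = - \<phi> f"
  using hom_add[of f "- f"] by (simp add: hom_0 eq_neg_iff_add_eq_0 add.commute)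

lemma hom_diff: "\<phi> (f - g) = \<phi> f - \<phi> g"
  using hom_add[of f "- g"] by (simp add: hom_uminus)

lemma hom_inverse: "\<phi> (inverse f) = inverse (\<phi> f)"
proof (cases "f = 0")
  case False
  then have "\<phi> f * \<phi> (inverse f) = 1"
    by (simp add: hom_1 flip: hom_mult)
  then show ?thesis by (metis inverse_unique)
qed (simp add: hom_0)

lemma hom_divide: "\<phi> (f / g) = \<phi> f / \<phi> g"
  by (simp add: divide_inverse hom_mult hom_inverse)

lemma hom_numeral: "\<phi> (numeral n) = numeral n"
  by (induction n) (simp_all only: numeral.simps hom_1 hom_add)

lemma hom_sum: "\<phi> (sum h A) = (\<Sum>x\<in>A. \<phi> (h x))"
  by (induction A rule: infinite_finite_induct) (simp_all add: hom_0 hom_add)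

lemma hom_prod: "\<phi> (prod h A) = (\<Prod>x\<in>A. \<phi> (h x))"
  by (induction A rule: infinite_finite_induct) (simp_all add: hom_1 hom_mult)

lemma hom_power: "\<phi> (f ^ n) = \<phi> f ^ n"
  by (induction n) (simp_all add: hom_1 hom_mult)

lemmas homs = hom_0 hom_1 hom_add hom_mult hom_uminus hom_diff hom_divide hom_numeral

lemma hom_coord_of: "\<phi> (coord_of P v) = coord_of (map_pt \<phi> P) v"
  by (cases P rule: Ham.cases; cases v) simp_all

lemma hom_poly_value: "\<phi> (poly_value const P p) = poly_value const (map_pt \<phi> P) p"
  by (simp add: poly_value_def hom_sum hom_prod hom_mult hom_power hom_const hom_coord_of)

end

text \<open>Numerator and denominator of \<open>f\<close> are polynomials in the generic coordinates
  with constant coefficients, and both maps fix the constants.\<close>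

lemma field_automorphism_eqI:
  assumes "field_automorphism \<phi>" and "field_automorphism \<psi>"
    and eq: "map_pt \<phi> generic = map_pt \<psi> generic"
  shows "\<phi> = \<psi>"
proof
  fix f :: ratfun
  interpret \<phi>: field_aut \<phi> by standard fact
  interpret \<psi>: field_aut \<psi> by standard fact
  show "\<phi> f = \<psi> f"
    by (cases f)
      (simp add: Fract_eq_poly_value \<phi>.hom_divide \<psi>.hom_divide \<phi>.hom_poly_value \<psi>.hom_poly_value eq)
qed

lemma field_automorphism_comp:
  "field_automorphism \<phi> \<Longrightarrow> field_automorphism \<psi> \<Longrightarrow> field_automorphism (\<phi> \<circ> \<psi>)"
  unfolding field_automorphism_def by (auto intro: bij_comp)

lemma (in evaluation) evals_coord_of:
  assumes "rel_pt (evals \<kappa> P) Q R"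
  shows "evals \<kappa> P (coord_of Q v) (coord_of R v)"
  using assms
  by (cases Q rule: Ham.cases; cases R rule: Ham.cases; cases v) simp_all

lemma (in evaluation) evals_sum:
  "(\<And>x. x \<in> A \<Longrightarrow> evals \<kappa> P (h x) (r x)) \<Longrightarrow> evals \<kappa> P (sum h A) (sum r A)"
  by (induction A rule: infinite_finite_induct) (simp_all add: evals_zero evals_add)

lemma (in evaluation) evals_prod:
  "(\<And>x. x \<in> A \<Longrightarrow> evals \<kappa> P (h x) (r x)) \<Longrightarrow> evals \<kappa> P (prod h A) (prod r A)"
  by (induction A rule: infinite_finite_induct) (simp_all add: evals_one evals_mult)

lemma (in evaluation) evals_power: "evals \<kappa> P f r \<Longrightarrow> evals \<kappa> P (f ^ n) (r ^ n)"
  by (induction n) (simp_all add: evals_one evals_mult)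

text \<open>Evaluation of a composite: if the coordinates of \<open>Q\<close> take the values
  \<open>R\<close> at \<open>P\<close>, then a polynomial in them takes its value at
  \<open>R\<close>. With \<open>Q = P\<close> and \<open>R = generic\<close> this is the statement
  that substituting twice changes nothing.\<close>

lemma (in evaluation) evals_poly_value:
  assumes "rel_pt (evals \<kappa> P) Q R"
  shows "evals \<kappa> P (poly_value const Q p) (poly_value \<kappa> R p)"
  unfolding poly_value_def
  by (intro evals_sum evals_mult evals_const evals_prod evals_power evals_coord_of assms)

text \<open>\<open>\<alpha>\<^sub>0\<close> is not a generator but the expression dictated by the
  normalisation, so its value at \<open>P\<close> agrees with the stored parameter only if
  \<open>P\<close> is normalised.\<close>

lemma (in evaluation) evals_generic:
  assumes "normalised (pt_params P)"
  shows "rel_pt (evals \<kappa> P) generic P"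
proof (cases P rule: Ham.cases)
  case (1 x y z w t a0 a1 a2 g1 b2 b3 b4)
  have "a0 = 1 - a1 - 2*a2 - 2*g1 - 2*b2 - b3 - b4"
    using assms by (simp add: 1 algebra_simps)
  moreover have "evals \<kappa> P (gen v) (coord_of P v)" for v
    by (rule evals_gen)
  note this[of Cx] this[of Cy] this[of Cz] this[of Cw] this[of Ct] this[of Ca1] this[of Ca2]
    this[of Cg1] this[of Cb2] this[of Cb3] this[of Cb4]
  ultimately show ?thesis
    by (auto simp: 1 generic_def intro!: evals_intros)
qed

text \<open>
  A polynomial \<open>q \<noteq> 0\<close> does not vanish at \<open>P\<close>: its value at \<open>P\<close> is a rational function whose own
  value at \<open>P\<close> is \<open>q\<close> again.
\<close>

lemma involutive_substitution:
  assumes norm: "normalised (pt_params P)"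
    and inv: "rel_pt (evals const P) P generic"
  shows "field_automorphism (subst P)" and "subst P \<circ> subst P = id"
    and "map_pt (subst P) generic = P"
proof -
  have nz: "poly_value const P q \<noteq> 0" if "q \<noteq> 0" for q
  proof
    assume "poly_value const P q = 0"
    then have "evals const P 0 (Fract q 1)"
      using const.evals_poly_value[OF inv, of q] by (simp add: poly_value_generic)
    then have "Fract q 1 = 0"
      using const.evals_unique const.evals_zero by blast
    then show False
      using that by (simp add: Zero_fract_def eq_fract)
  qed
  have ev: "evals const P f (subst P f)" for f
  proof -
    obtain p q where "f = Fract p q" "q \<noteq> 0" by (cases f)
    then show ?thesis
      unfolding subst_def
      using const.evals_Fract[OF nz, of q p] const.rat_value_eq by metis
  qed
  have eqI: "subst P f = r" if "evals const P f r" for f r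
    using that by (simp add: subst_def const.rat_value_eq)
  have invol: "subst P (subst P f) = f" for f
  proof -
    obtain p q where f: "f = Fract p q" "q \<noteq> 0" by (cases f)
    have *: "evals const P (poly_value const P p) (Fract p 1)" for p
      using const.evals_poly_value[OF inv, of p] by (simp add: poly_value_generic)
    have "subst P f = poly_value const P p / poly_value const P q"
      unfolding f(1) by (intro eqI const.evals_Fract nz f(2))
    moreover have "Fract q 1 \<noteq> 0"
      using f(2) by (simp add: Zero_fract_def eq_fract)
    ultimately have "subst P (subst P f) = Fract p 1 / Fract q 1"
      by (simp only:) (intro eqI const.evals_divide *)
    then show ?thesis using f by simp
  qed
  then show "subst P \<circ> subst P = id" by (simp add: fun_eq_iff)
  have "bij (subst P)" by (rule involuntory_imp_bij) (rule invol)
  then show "field_automorphism (subst P)"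
    unfolding field_automorphism_def
    by (auto intro!: eqI const.evals_intros ev)
  have "rel_pt (\<lambda>f r. subst P f = r) generic P"
    using const.evals_generic[OF norm] by (rule pt.rel_mono_strong) (rule eqI)
  then have "rel_pt (=) (map_pt (subst P) generic) P"
    by (simp add: pt.rel_map)
  then show "map_pt (subst P) generic = P"
    by (simp add: pt.rel_eq)
qed


section \<open>The generators as maps over a field\<close>

lemma s_map_simps [simp]:
  "s_map 0 = s0_map" "s_map (Suc 0) = s1_map" "s_map 2 = s2_map" "s_map 3 = s3_map"
  "s_map 4 = s4_map" "s_map 5 = s5_map" "s_map 6 = s6_map"
  by (simp_all add: s_map_def fun_eq_iff)

lemma pi_map_simps [simp]:
  "pi_map (Suc 0) = pi1_map" "pi_map 2 = pi2_map" "pi_map 3 = pi3_map" "pi_map 4 = pi4_map"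
  by (simp_all add: pi_map_def fun_eq_iff)

text \<open>Outside these sets the total division of HOL gives the maps values without meaning, so
  the identities between the maps are stated on them.\<close>

fun s_dom :: "nat \<Rightarrow> 'a::field pt \<Rightarrow> bool" where
  "s_dom i (Pt x y z w t \<theta>) = [x \<noteq> t, True, y \<noteq> 0, x \<noteq> z, w \<noteq> 0, z \<noteq> 1, z \<noteq> 0] ! i"

fun pi_dom :: "nat \<Rightarrow> 'a::field pt \<Rightarrow> bool" where
  "pi_dom j (Pt x y z w t \<theta>) =
     [x \<noteq> t \<and> z \<noteq> t \<and> t \<noteq> 0 \<and> t \<noteq> 1, x \<noteq> 0 \<and> z \<noteq> 0 \<and> t \<noteq> 0, True,
      x \<noteq> t \<and> z \<noteq> t \<and> t \<noteq> 0 \<and> t \<noteq> 1] ! (j - 1)"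

lemma less_7_cases:
  assumes "i \<le> (6::nat)"
  obtains "i = 0" | "i = Suc 0" | "i = 2" | "i = 3" | "i = 4" | "i = 5" | "i = 6"
  using assms by atomize_elim auto

lemma one_to_4_cases:
  assumes "j \<in> {1..4::nat}"
  obtains "j = Suc 0" | "j = 2" | "j = 3" | "j = 4"
  using assms by atomize_elim auto

lemma s_map_involution:
  assumes "i \<le> 6" and "s_dom i P"
  shows "s_map i (s_map i P) = P" and "s_dom i (s_map i P)"
  using assms
  by (cases P rule: Ham.cases; cases i rule: less_7_cases; simp; fail)+

lemma pi_map_involution:
  assumes "j \<in> {1..4}" and "pi_dom j P"
  shows "pi_map j (pi_map j P) = P" and "pi_dom j (pi_map j P)"
proof -
  obtain x y z w t a0 a1 a2 g1 b2 b3 b4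
    where P: "P = Pt x y z w t (Params a0 a1 a2 g1 b2 b3 b4)"
    by (cases P rule: Ham.cases)
  show "pi_map j (pi_map j P) = P"
    using assms(1)
  proof (cases j rule: one_to_4_cases)
    case 1
    then show ?thesis using assms(2) unfolding P by (simp add: divide_simps; simp add: algebra_simps)
  next
    case 2
    then show ?thesis using assms(2) unfolding P by (simp add: divide_simps; simp add: algebra_simps)
  next
    case 3
    then show ?thesis using assms(2) unfolding P by simp
  next
    case 4
    then have "x \<noteq> t" "t \<noteq> x" "z \<noteq> t" "t \<noteq> z" "t \<noteq> 0" "t \<noteq> 1"
      using assms(2) unfolding P by auto
    then show ?thesis using 4 unfolding P by (simp add: divide_simps; simp add: algebra_simps)
  qed
  have "pi_dom 4 P \<Longrightarrow> pi_dom 4 (pi_map 4 P)"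
  proof -
    assume *: "pi_dom 4 P"
    then have nz: "x \<noteq> t" "t - x \<noteq> 0" "z \<noteq> t" "t - z \<noteq> 0" "t \<noteq> 0" "t \<noteq> 1" "1 - t \<noteq> 0"
      unfolding P by auto
    \<comment> \<open>The transformed \<open>x\<close> minus the transformed \<open>t\<close>. Its
      nonvanishing is the condition \<open>x \<noteq> t\<close> at the image point.\<close>
    have "(t - 1) * x / (t - x) - (1 - t) = t * (t - 1) / (t - x)"
      and "(t - 1) * z / (t - z) - (1 - t) = t * (t - 1) / (t - z)"
      using nz by (simp_all add: divide_simps) (simp_all add: algebra_simps)
    with nz show ?thesis unfolding P by auto
  qed
  note case_4 = this
  show "pi_dom j (pi_map j P)"
    using assms case_4 unfolding P
    by (cases j rule: one_to_4_cases) (simp_all add: divide_simps, (simp add: algebra_simps)?)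
qed

text \<open>The left-hand side of the normalisation is the null root of the affine root system, with
  the weights 1, 1, 2, 2, 2, 1, 1, and every simple reflection fixes it.\<close>

lemma normalised_s_map:
  fixes P :: "'a::field pt"
  assumes "i \<le> 6" and "normalised (pt_params P)"
  shows "normalised (pt_params (s_map i P))"
  using assms
  by (cases P rule: Ham.cases; cases i rule: less_7_cases) (simp_all add: algebra_simps)

lemma normalised_pi_map:
  fixes P :: "'a::field pt"
  assumes "j \<in> {1..4}" and "normalised (pt_params P)"
  shows "normalised (pt_params (pi_map j P))"
  using assms
  by (cases P rule: Ham.cases; cases j rule: one_to_4_cases) (simp_all add: algebra_simps)

lemma normalised_generic: "normalised (pt_params generic)"
  by (simp add: generic_def)

context evaluation
begin

lemma evals_s_map:
  assumes "i \<le> 6" and "rel_pt (evals \<kappa> R) Q P" and "s_dom i P"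
  shows "rel_pt (evals \<kappa> R) (s_map i Q) (s_map i P)"
  using assms
  by (cases P rule: Ham.cases; cases Q rule: Ham.cases; cases i rule: less_7_cases)
    (auto intro!: evals_intros)

lemma evals_pi_map:
  assumes "j \<in> {1..4}" and "rel_pt (evals \<kappa> R) Q P" and "pi_dom j P"
  shows "rel_pt (evals \<kappa> R) (pi_map j Q) (pi_map j P)"
  using assms
  by (cases P rule: Ham.cases; cases Q rule: Ham.cases; cases j rule: one_to_4_cases)
    (auto intro!: evals_intros)

end

lemma gen_nonzero: "gen v \<noteq> 0"
  by (auto simp: gen_def Zero_fract_def eq_fract dest!: arg_cong[where f = Poly_Mapping.keys])

lemma gen_diff_nonzero: "u \<noteq> v \<Longrightarrow> gen u \<noteq> gen v"
  by (auto simp: gen_def eq_fract dest!: arg_cong[where f = Poly_Mapping.keys])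

lemma gen_neq_1: "gen v \<noteq> 1"
  by (auto simp: gen_def One_fract_def eq_fract dest!: arg_cong[where f = Poly_Mapping.keys])

lemma s_dom_generic: "i \<le> 6 \<Longrightarrow> s_dom i generic"
  by (cases i rule: less_7_cases) (simp_all add: generic_def gen_nonzero gen_neq_1 gen_diff_nonzero)

lemma pi_dom_generic: "j \<in> {1..4} \<Longrightarrow> pi_dom j generic"
  by (cases j rule: one_to_4_cases) (simp_all add: generic_def gen_nonzero gen_neq_1 gen_diff_nonzero)

context field_aut
begin

lemma hom_eq_iff [simp]: "\<phi> f = \<phi> g \<longleftrightarrow> f = g"
  using aut unfolding field_automorphism_def bij_def inj_def by blast

lemma hom_eq_0_iff [simp]: "\<phi> f = 0 \<longleftrightarrow> f = 0"
  using hom_eq_iff[of f 0] by (simp only: hom_0)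

lemma hom_eq_1_iff [simp]: "\<phi> f = 1 \<longleftrightarrow> f = 1"
  using hom_eq_iff[of f 1] by (simp only: hom_1)

text \<open>The coordinates of the maps are rational expressions with integer coefficients, so they
  commute with every automorphism, division by zero included. Injectivity of the automorphism
  carries the domain along.\<close>

lemma map_pt_s_map:
  assumes "i \<le> 6"
  shows "map_pt \<phi> (s_map i P) = s_map i (map_pt \<phi> P)" and "s_dom i (map_pt \<phi> P) = s_dom i P"
  using assms by (cases P rule: Ham.cases; cases i rule: less_7_cases; simp add: homs; fail)+

lemma map_pt_pi_map:
  assumes "j \<in> {1..4}"
  shows "map_pt \<phi> (pi_map j P) = pi_map j (map_pt \<phi> P)" and "pi_dom j (map_pt \<phi> P) = pi_dom j P"
  using assms by (cases P rule: Ham.cases; cases j rule: one_to_4_cases; simp add: homs; fail)+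

end

lemma s_aut_properties:
  assumes "i \<le> 6"
  shows "field_automorphism (s_aut i)" and "s_aut i \<circ> s_aut i = id"
    and "map_pt (s_aut i) generic = s_map i generic"
proof -
  let ?P = "s_map i generic"
  have "normalised (pt_params ?P)"
    by (intro normalised_s_map assms normalised_generic)
  note norm = this
  \<comment> \<open>The formulas in \<open>?P\<close>, evaluated at \<open>?P\<close>, give
    \<open>s_map i ?P\<close>, which is \<open>generic\<close> again because the map is an
    involution.\<close>
  have "rel_pt (evals const ?P) ?P (s_map i ?P)"
    by (intro const.evals_s_map const.evals_generic s_map_involution s_dom_generic assms norm)
  then have "rel_pt (evals const ?P) ?P generic"
    by (simp only: s_map_involution(1)[OF assms s_dom_generic[OF assms]])
  note * = involutive_substitution[OF norm this]
  show "field_automorphism (s_aut i)" and "s_aut i \<circ> s_aut i = id"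
    and "map_pt (s_aut i) generic = s_map i generic"
    unfolding s_aut_def by (fact *)+
qed

lemma pi_aut_properties:
  assumes "j \<in> {1..4}"
  shows "field_automorphism (pi_aut j)" and "pi_aut j \<circ> pi_aut j = id"
    and "map_pt (pi_aut j) generic = pi_map j generic"
proof -
  let ?P = "pi_map j generic"
  have "normalised (pt_params ?P)"
    by (intro normalised_pi_map assms normalised_generic)
  note norm = this
  have "rel_pt (evals const ?P) ?P (pi_map j ?P)"
    by (intro const.evals_pi_map const.evals_generic pi_map_involution pi_dom_generic assms norm)
  then have "rel_pt (evals const ?P) ?P generic"
    by (simp only: pi_map_involution(1)[OF assms pi_dom_generic[OF assms]])
  note * = involutive_substitution[OF norm this]
  show "field_automorphism (pi_aut j)" and "pi_aut j \<circ> pi_aut j = id"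
    and "map_pt (pi_aut j) generic = pi_map j generic"
    unfolding pi_aut_def by (fact *)+
qed

section \<open>The Coxeter relations\<close>

lemma s_map_commute:
  fixes P :: "'a::field pt"
  assumes "i \<le> 6" and "j \<le> 6" and "i < j" and "{i, j} \<notin> D6_edges"
    and "s_dom i P" and "s_dom j P" and "s_dom j (s_map i P)" and "s_dom i (s_map j P)"
  shows "s_map i (s_map j P) = s_map j (s_map i P)"
proof -
  obtain x y z w t a0 a1 a2 g1 b2 b3 b4
    where P: "P = Pt x y z w t (Params a0 a1 a2 g1 b2 b3 b4)"
    by (cases P rule: Ham.cases)
  show ?thesis
    by (rule less_7_cases[OF assms(1)]; rule less_7_cases[OF assms(2)]; insert assms(3,4))
      (simp_all add: P D6_edges_def doubleton_eq_iff)
qed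

text \<open>The two conclusions compare the total shifts of \<open>u\<close> and of \<open>v\<close>
  along the two sides of the braid relation; the middle reflection carries the parameter
  \<open>a + b\<close>. In terms of \<open>D\<close> and \<open>E\<close> the intermediate values
  are the monomials \<open>E / u\<close>, \<open>D / v\<close>, \<open>u * D / E\<close> and
  \<open>v * E / D\<close>. Eliminating \<open>a\<close> and \<open>b\<close> therefore leaves no
  sum in a denominator, and the hypotheses become nonvanishing of atoms.\<close>

lemma A2_braid:
  fixes u v a b :: "'a::field"
  assumes "u \<noteq> 0" and "v \<noteq> 0" and "v - a / u \<noteq> 0" and "u + b / v \<noteq> 0"
  shows "(a + b) / (v - a / u) = b / v + a / (v - (a + b) / (u + b / v))"
    and "a / u + b / (u + (a + b) / (v - a / u)) = (a + b) / (u + b / v)"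
proof -
  define D where "D = u * v + b"
  define E where "E = u * v - a"
  have b: "b = D - u * v" and a: "a = u * v - E" by (simp_all add: D_def E_def)
  have D: "u + b / v = D / v" and E: "v - a / u = E / u" 
    using assms(1,2) by (simp_all add: a b divide_simps)
  then have nz: "D \<noteq> 0" "E \<noteq> 0" using assms by auto
  have "u + (a + b) / (E / u) = u * D / E" and "v - (a + b) / (D / v) = v * E / D"
    using assms(1,2) nz by (simp_all add: a b divide_simps) (simp_all add: algebra_simps)
  then show "(a + b) / (v - a / u) = b / v + a / (v - (a + b) / (u + b / v))"
    and "a / u + b / (u + (a + b) / (v - a / u)) = (a + b) / (u + b / v)"
    unfolding D E using assms(1,2) nz
    by (simp_all add: a b divide_simps) (simp_all add: algebra_simps)
qed

text \<open>The version with both signs reversed, needed for the edge between 3 and 4: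
  \<open>s4_map\<close> raises \<open>z\<close> and so lowers \<open>x - z\<close>, while
  \<open>s3_map\<close> raises \<open>w\<close>.\<close>

lemma A2_braid_uminus:
  fixes u v a b :: "'a::field"
  assumes "u \<noteq> 0" and "v \<noteq> 0" and "v + a / u \<noteq> 0" and "u - b / v \<noteq> 0"
  shows "(a + b) / (v + a / u) = b / v + a / (v + (a + b) / (u - b / v))"
    and "a / u + b / (u - (a + b) / (v + a / u)) = (a + b) / (u - b / v)"
proof -
  have "- a - b = - (a + b)" by simp
  note * = A2_braid[of u v "- a" "- b",
      unfolded add_uminus_conv_diff this divide_minus_left diff_minus_eq_add, OF assms]
  have aux: "- p = - q - r \<Longrightarrow> p = q + r" for p q r :: 'a
    by (metis add.commute minus_add_distrib minus_minus uminus_add_conv_diff)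
  show "(a + b) / (v + a / u) = b / v + a / (v + (a + b) / (u - b / v))"
    using *(1) by (rule aux)
  show "a / u + b / (u - (a + b) / (v + a / u)) = (a + b) / (u - b / v)"
    using *(2)[symmetric] by (rule aux[symmetric])
qed

lemma s_map_braid:
  fixes P :: "'a::field pt"
  assumes "i \<le> 6" and "j \<le> 6" and "i < j" and "{i, j} \<in> D6_edges"
    and "s_dom i P" and "s_dom j P" and "s_dom j (s_map i P)" and "s_dom i (s_map j P)"
  shows "s_map i (s_map j (s_map i P)) = s_map j (s_map i (s_map j P))"
proof -
  obtain x y z w t a0 a1 a2 g1 b2 b3 b4
    where P: "P = Pt x y z w t (Params a0 a1 a2 g1 b2 b3 b4)"
    by (cases P rule: Ham.cases)
  consider "i = 0" "j = 2" | "i = Suc 0" "j = 2" | "i = 2" "j = 3" | "i = 3" "j = 4"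
    | "i = 4" "j = 5" | "i = 4" "j = 6"
    using assms(3,4) by (auto simp: D6_edges_def doubleton_eq_iff)
  then show ?thesis
  proof cases
    case 1
    define u where "u = x - t"
    then have x: "x = u + t" by simp
    show ?thesis
      using assms(5-8) A2_braid[of u y a0 a2] unfolding P 1 x by (simp add: algebra_simps)
  next
    case 2
    \<comment> \<open>\<open>s1_map\<close> fixes all coordinates. What remains is that the shift
      \<open>(a1 + a2) / y\<close> of \<open>x\<close> splits into \<open>a2 / y\<close> and
      \<open>a1 / y\<close>.\<close>
    then show ?thesis unfolding P by (simp add: add_divide_distrib)
  next
    case 3
    define u where "u = x - z"
    then have x: "x = u + z" by simp
    show ?thesis
      using assms(5-8) A2_braid[of u y g1 a2] unfolding P 3 x by (simp add: algebra_simps)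
  next
    case 4
    \<comment> \<open>The shift of \<open>y\<close> by \<open>s3_map\<close> is the negative of that
      of \<open>w\<close>, so the one identity for \<open>u\<close> and \<open>w\<close> settles
      both components.\<close>
    define u where "u = x - z"
    then have x: "x = u + z" by simp
    have minus: "p + (- q - r) = p - (q + r)" "- p - q = - r \<longleftrightarrow> p + q = r" for p q r :: 'a
      by (auto simp: eq_neg_iff_add_eq_0 algebra_simps)
    have nz: "u \<noteq> 0" "w \<noteq> 0" "w + g1 / u \<noteq> 0" "u - b2 / w \<noteq> 0"
      using assms(5-8) unfolding P 4 x by auto
    show ?thesis
      using nz A2_braid_uminus[OF nz] unfolding P 4 x
      by (simp add: add.commute[of b2 g1]) (simp add: minus)
  next
    case 5
    define u where "u = z - 1"
    then have x: "z = u + 1" by simp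
    show ?thesis
      using assms(5-8) A2_braid[of u w b3 b2] unfolding P 5 x by (simp add: algebra_simps)
  next
    case 6
    show ?thesis
      using assms(5-8) A2_braid[of z w b4 b2] unfolding P 6 by (simp add: algebra_simps)
  qed
qed

section \<open>Conjugation of the reflections by the diagram automorphisms\<close>

lemma pi_map_s_map:
  fixes P :: "'a::field pt"
  assumes "j \<in> {1..4}" and "i \<le> 6"
    and "pi_dom j P" and "s_dom (D6_sigma j i) P"
    and "s_dom i (pi_map j P)" and "pi_dom j (s_map (D6_sigma j i) P)"
  shows "s_map i (pi_map j P) = pi_map j (s_map (D6_sigma j i) P)"
proof -
  obtain x y z w t a0 a1 a2 g1 b2 b3 b4
    where P: "P = Pt x y z w t (Params a0 a1 a2 g1 b2 b3 b4)"
    by (cases P rule: Ham.cases)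
  show ?thesis
    using assms(1)
  proof (cases j rule: one_to_4_cases)
    case 1
    show ?thesis using assms(2) assms(3-) unfolding P 1
      by (cases i rule: less_7_cases) (simp_all add: D6_sigma_def divide_simps, (simp_all add: algebra_simps)?)
  next
    case 2
    show ?thesis using assms(2) assms(3-) unfolding P 2
      by (cases i rule: less_7_cases) (simp_all add: D6_sigma_def divide_simps, (simp_all add: algebra_simps)?)
  next
    case 3
    show ?thesis using assms(2) assms(3-) unfolding P 3
      by (cases i rule: less_7_cases) (simp_all add: D6_sigma_def divide_simps, (simp_all add: algebra_simps)?)
  next
    case 4
    \<comment> \<open>Both orientations are supplied because \<open>pi4_map\<close> divides by
      \<open>t - x\<close> and \<open>t - z\<close>, whereas \<open>pi_dom\<close> and
      \<open>s0_map\<close> are phrased with \<open>x - t\<close>.\<close>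
    then have "x \<noteq> t" "t \<noteq> x" "z \<noteq> t" "t \<noteq> z" "t \<noteq> 0" "t \<noteq> 1"
      using assms(3) unfolding P by auto
    note this [simp]
    show ?thesis using assms(2) assms(3-) unfolding P 4
      by (cases i rule: less_7_cases) (simp_all add: D6_sigma_def divide_simps, (simp_all add: algebra_simps)?)
  qed
qed

text \<open>The second claim yields the domain conditions at an image of the generic point for free:
  \<open>s_aut i\<close> is injective and takes \<open>generic\<close> to that image.\<close>

lemma s_aut_apply:
  assumes "i \<le> 6" and "k \<le> 6"
  shows "map_pt (s_aut i) (s_map k P) = s_map k (map_pt (s_aut i) P)"
    and "s_dom k (s_map i generic)"
proof -
  interpret field_aut "s_aut i" by standard (rule s_aut_properties(1)[OF assms(1)])
  show "map_pt (s_aut i) (s_map k P) = s_map k (map_pt (s_aut i) P)"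
    by (rule map_pt_s_map(1)[OF assms(2)])
  show "s_dom k (s_map i generic)"
    using map_pt_s_map(2)[OF assms(2), of generic] s_dom_generic[OF assms(2)]
    by (simp add: s_aut_properties(3)[OF assms(1)])
qed

text \<open>Composing automorphisms reverses the order of the maps:
  \<open>s_aut i \<circ> s_aut j\<close> takes \<open>generic\<close> to
  \<open>s_map j (s_map i generic)\<close>. Commutation and the braid relation are unaffected by
  this reversal.\<close>

lemma s_aut_relation:
  assumes "i \<le> 6" and "j \<le> 6" and "i < j"
  shows "{i, j} \<notin> D6_edges \<Longrightarrow> s_aut i \<circ> s_aut j = s_aut j \<circ> s_aut i"
    and "{i, j} \<in> D6_edges \<Longrightarrow>
      s_aut i \<circ> s_aut j \<circ> s_aut i = s_aut j \<circ> s_aut i \<circ> s_aut j"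
proof -
  note dom = s_dom_generic[OF assms(1)] s_dom_generic[OF assms(2)]
    s_aut_apply(2)[OF assms(1,2)] s_aut_apply(2)[OF assms(2,1)]
  note map = pt.map_comp[symmetric] s_aut_properties(3)[OF assms(1)] s_aut_properties(3)[OF assms(2)]
    s_aut_apply(1)[OF assms(1,1)] s_aut_apply(1)[OF assms(1,2)] s_aut_apply(1)[OF assms(2,1)]
    s_aut_apply(1)[OF assms(2,2)]
  note aut = s_aut_properties(1)[OF assms(1)] s_aut_properties(1)[OF assms(2)]
  show "s_aut i \<circ> s_aut j = s_aut j \<circ> s_aut i" if "{i, j} \<notin> D6_edges"
    using s_map_commute[OF assms that dom]
    by (intro field_automorphism_eqI field_automorphism_comp aut) (simp only: map)
  show "s_aut i \<circ> s_aut j \<circ> s_aut i = s_aut j \<circ> s_aut i \<circ> s_aut j" if "{i, j} \<in> D6_edges"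
    using s_map_braid[OF assms that dom]
    by (intro field_automorphism_eqI field_automorphism_comp aut) (simp only: map)
qed

text \<open>For involutions, the braid relation and commutation say that the product has third,
  respectively second, power equal to the identity.\<close>

lemma s_aut_order:
  assumes "i \<le> 6" and "j \<le> 6" and "i \<noteq> j"
  shows "(s_aut i \<circ> s_aut j) ^^ D6_m i j = id"
proof -
  have sq: "s_aut k (s_aut k f) = f" if "k \<le> 6" for k f
    using s_aut_properties(2)[OF that] by (simp add: fun_eq_iff)
  show ?thesis
  proof (cases "{i, j} \<in> D6_edges")
    case True
    have "s_aut i \<circ> s_aut j \<circ> s_aut i = s_aut j \<circ> s_aut i \<circ> s_aut j"
      using s_aut_relation(2)[of i j] s_aut_relation(2)[of j i] assms True
      by (cases "i < j") (simp_all add: insert_commute)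
    then have "s_aut i (s_aut j (s_aut i f)) = s_aut j (s_aut i (s_aut j f))" for f
      by (simp add: fun_eq_iff)
    then show ?thesis
      using assms True by (simp add: fun_eq_iff D6_m_def numeral_3_eq_3 sq)
  next
    case False
    have "s_aut i \<circ> s_aut j = s_aut j \<circ> s_aut i"
      using s_aut_relation(1)[of i j] s_aut_relation(1)[of j i] assms False
      by (cases "i < j") (simp_all add: insert_commute)
    then have "s_aut i (s_aut j f) = s_aut j (s_aut i f)" for f
      by (simp add: fun_eq_iff)
    then show ?thesis
      using assms False by (simp add: fun_eq_iff D6_m_def numeral_2_eq_2 sq)
  qed
qed

lemma D6_sigma_le: "j \<in> {1..4} \<Longrightarrow> i \<le> 6 \<Longrightarrow> D6_sigma j i \<le> 6"
  by (cases j rule: one_to_4_cases) (simp_all add: D6_sigma_def)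

text \<open>Proved without the inverse, as
  \<open>pi_aut j \<circ> s_aut i = s_aut ?k \<circ> pi_aut j\<close>. The two sides take
  \<open>generic\<close> to the two points that \<open>pi_map_s_map\<close> identifies.\<close>

lemma pi_aut_conjugation:
  assumes "j \<in> {1..4}" and "i \<le> 6"
  shows "pi_aut j \<circ> s_aut i \<circ> inv (pi_aut j) = s_aut (D6_sigma j i)"
proof -
  let ?k = "D6_sigma j i"
  note k = D6_sigma_le[OF assms]
  interpret p: field_aut "pi_aut j" by standard (rule pi_aut_properties(1)[OF assms(1)])
  interpret s: field_aut "s_aut ?k" by standard (rule s_aut_properties(1)[OF k])
  have "s_dom i (pi_map j generic)"
    using p.map_pt_s_map(2)[OF assms(2), of generic] s_dom_generic[OF assms(2)]
    by (simp only: pi_aut_properties(3)[OF assms(1)])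
  moreover have "pi_dom j (s_map ?k generic)"
    using s.map_pt_pi_map(2)[OF assms(1), of generic] pi_dom_generic[OF assms(1)]
    by (simp only: s_aut_properties(3)[OF k])
  ultimately have "s_map i (pi_map j generic) = pi_map j (s_map ?k generic)"
    by (intro pi_map_s_map assms pi_dom_generic s_dom_generic k)
  then have "pi_aut j \<circ> s_aut i = s_aut ?k \<circ> pi_aut j"
    by (intro field_automorphism_eqI field_automorphism_comp pi_aut_properties(1)
        s_aut_properties(1) assms k)
      (simp only: pt.map_comp[symmetric] s_aut_properties(3)[OF k] s_aut_properties(3)[OF assms(2)]
        pi_aut_properties(3)[OF assms(1)] p.map_pt_s_map(1)[OF assms(2)]
        s.map_pt_pi_map(1)[OF assms(1)])
  moreover have "pi_aut j \<circ> inv (pi_aut j) = id"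
    using p.aut bij_is_surj surj_iff unfolding field_automorphism_def by metis
  ultimately show ?thesis
    by (metis comp_assoc comp_id)
qed


section \<open>The subfield of functions of the parameters\<close>

lemma param_poly_add: "param_poly p \<Longrightarrow> param_poly q \<Longrightarrow> param_poly (p + q)"
  using keys_add[of p q] unfolding param_poly_def by blast

lemma param_poly_mult:
  assumes "param_poly p" and "param_poly q"
  shows "param_poly (p * q)"
  unfolding param_poly_def
proof
  fix m assume "m \<in> Poly_Mapping.keys (p * q)"
  then obtain a b where "m = a + b" "a \<in> Poly_Mapping.keys p" "b \<in> Poly_Mapping.keys q"
    using keys_mult[of p q] by blast
  then show "Poly_Mapping.keys m \<subseteq> {Ca1, Ca2, Cg1, Cb2, Cb3, Cb4}"
    using keys_add[of a b] assms unfolding param_poly_def by blast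
qed

lemma param_poly_uminus: "param_poly p \<Longrightarrow> param_poly (- p)"
  unfolding param_poly_def by (simp add: in_keys_iff)

lemma param_fieldI: "param_poly p \<Longrightarrow> param_poly q \<Longrightarrow> q \<noteq> 0 \<Longrightarrow> Fract p q \<in> param_field"
  unfolding param_field_def by blast

lemma param_field_add:
  assumes "f \<in> param_field" and "g \<in> param_field"
  shows "f + g \<in> param_field"
proof -
  obtain p q p' q' where "f = Fract p q" "g = Fract p' q'" "q \<noteq> 0" "q' \<noteq> 0"
    "param_poly p" "param_poly q" "param_poly p'" "param_poly q'"
    using assms unfolding param_field_def by blast
  then have "f + g = Fract (p * q' + p' * q) (q * q')" "q * q' \<noteq> 0"
    "param_poly (p * q' + p' * q)" "param_poly (q * q')"
    by (simp_all add: param_poly_add param_poly_mult)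
  then show ?thesis unfolding param_field_def by blast
qed

lemma param_field_mult:
  assumes "f \<in> param_field" and "g \<in> param_field"
  shows "f * g \<in> param_field"
proof -
  obtain p q p' q' where "f = Fract p q" "g = Fract p' q'" "q \<noteq> 0" "q' \<noteq> 0"
    "param_poly p" "param_poly q" "param_poly p'" "param_poly q'"
    using assms unfolding param_field_def by blast
  then have "f * g = Fract (p * p') (q * q')" "q * q' \<noteq> 0"
    "param_poly (p * p')" "param_poly (q * q')"
    by (simp_all add: param_poly_mult)
  then show ?thesis unfolding param_field_def by blast
qed

lemma param_field_const: "const c \<in> param_field"
proof -
  have "param_poly (Poly_Mapping.single 0 c)" "param_poly 1"
    by (simp_all add: param_poly_def)
  then show ?thesis
    unfolding const_def by (intro param_fieldI) simp_all
qed

lemma param_field_0: "0 \<in> param_field" and param_field_1: "1 \<in> param_field"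
  using param_field_const[of 0] param_field_const[of 1] by (simp_all add: const.zero const.one)

lemma param_field_uminus: "f \<in> param_field \<Longrightarrow> - f \<in> param_field"
  unfolding param_field_def using param_poly_uminus by fastforce

lemma param_field_diff: "f \<in> param_field \<Longrightarrow> g \<in> param_field \<Longrightarrow> f - g \<in> param_field"
  using param_field_add[of f "- g"] param_field_uminus[of g] by simp

lemma param_field_divide:
  assumes "f \<in> param_field" and "g \<in> param_field"
  shows "f / g \<in> param_field"
proof (cases "g = 0")
  case False
  obtain p q where g: "g = Fract p q" "q \<noteq> 0" "param_poly p" "param_poly q"
    using assms unfolding param_field_def by blast
  then have "p \<noteq> 0" using False by (auto simp: fract_collapse)
  then have "inverse g \<in> param_field"
    using g unfolding param_field_def by auto
  then show ?thesis
    using assms(1) by (simp add: divide_inverse param_field_mult)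
qed (simp add: param_field_0)

lemma param_field_numeral: "numeral n \<in> param_field"
  by (induction n) (simp_all only: numeral.simps param_field_1 param_field_add)

lemma param_field_gen:
  assumes "v \<in> {Ca1, Ca2, Cg1, Cb2, Cb3, Cb4}"
  shows "gen v \<in> param_field"
proof -
  have "param_poly (Poly_Mapping.single (Poly_Mapping.single v 1) 1)" "param_poly 1"
    using assms by (simp_all add: param_poly_def)
  then show ?thesis
    unfolding gen_def by (intro param_fieldI) simp_all
qed

lemma param_field_sum: "(\<And>x. x \<in> A \<Longrightarrow> h x \<in> param_field) \<Longrightarrow> sum h A \<in> param_field"
  by (induction A rule: infinite_finite_induct) (simp_all add: param_field_0 param_field_add)

lemma param_field_prod: "(\<And>x. x \<in> A \<Longrightarrow> h x \<in> param_field) \<Longrightarrow> prod h A \<in> param_field"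
  by (induction A rule: infinite_finite_induct) (simp_all add: param_field_1 param_field_mult)

lemma param_field_power: "f \<in> param_field \<Longrightarrow> f ^ n \<in> param_field"
  by (induction n) (simp_all add: param_field_1 param_field_mult)

lemma param_field_poly_value:
  assumes "set_params (pt_params P) \<subseteq> param_field" and "param_poly p"
  shows "poly_value const P p \<in> param_field"
proof -
  have "coord_of P v \<in> param_field" if "v \<in> {Ca1, Ca2, Cg1, Cb2, Cb3, Cb4}" for v
    using assms(1) that by (cases P rule: Ham.cases) auto
  then show ?thesis
    using assms(2) unfolding poly_value_def param_poly_def
    by (intro param_field_sum param_field_mult param_field_const param_field_prod
        param_field_power) blast
qed

text \<open>The images of the parameters give one inclusion, and the involution turns it into
  equality, since every \<open>f\<close> is the image of \<open>\<phi> f\<close>.\<close>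

lemma (in field_aut) param_field_image:
  assumes "\<phi> \<circ> \<phi> = id" and "set_params (pt_params (map_pt \<phi> generic)) \<subseteq> param_field"
  shows "\<phi> ` param_field = param_field"
proof -
  have sub: "\<phi> f \<in> param_field" if f: "f \<in> param_field" for f
  proof -
    obtain p q where "f = Fract p q" "param_poly p" "param_poly q" "q \<noteq> 0"
      using f unfolding param_field_def by blast
    then show ?thesis
      using assms(2)
      by (simp add: Fract_eq_poly_value hom_divide hom_poly_value param_field_divide
          param_field_poly_value)
  qed
  moreover have "f = \<phi> (\<phi> f)" for f
    using assms(1) by (simp add: fun_eq_iff)
  ultimately show ?thesis by blast
qed

lemmas param_field_intros = param_field_gen param_field_1 param_field_numeral param_field_uminus
  param_field_add param_field_diff param_field_mult

lemma set_params_generic: "set_params (pt_params generic) \<subseteq> param_field"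
  by (auto simp: generic_def intro!: param_field_intros)

lemma set_params_s_map:
  assumes "i \<le> 6" and "set_params (pt_params P) \<subseteq> param_field"
  shows "set_params (pt_params (s_map i P)) \<subseteq> param_field"
  by (rule less_7_cases[OF assms(1)]; cases P rule: Ham.cases; insert assms(2))
    (auto intro!: param_field_intros)

lemma set_params_pi_map:
  assumes "j \<in> {1..4}" and "set_params (pt_params P) \<subseteq> param_field"
  shows "set_params (pt_params (pi_map j P)) \<subseteq> param_field"
  by (rule one_to_4_cases[OF assms(1)]; cases P rule: Ham.cases; insert assms(2)) auto


section \<open>Transport of solutions\<close>

text \<open>A single denominator that depends on \<open>t\<close> alone: the partial derivatives in
  the four canonical variables then only concern the polynomial numerator.\<close>

lemma Ham_eq_quotient:
  "Ham (Pt x y z w t (Params a0 a1 a2 g1 b2 b3 b4)) =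
    (y^2*(x - t)*(x - 1)*x
      - ((a0 - 1)*(x - 1)*x + (g1 + 2*b2 + b3)*(x - t)*x + (g1 + b4)*(x - t)*(x - 1))*y
      + a2*(a1 + a2)*x
      + (w^2*(z - t)*(z - 1)*z - ((a0 + g1 - 1)*(z - 1)*z + b3*(z - t)*z + b4*(z - t)*(z - 1))*w
        + b2*(a1 + 2*a2 + g1 + b2)*z)
      + 2*(x - t)*y*z*((z - 1)*w + b2)) / (t*(t - 1))"
  by (simp add: H_VI_def Let_def add_divide_distrib)

lemma Ham_y_eq:
  "Ham_y (Pt x y z w t (Params a0 a1 a2 g1 b2 b3 b4)) =
    (2*y*(x - t)*(x - 1)*x - ((a0 - 1)*(x - 1)*x + (g1 + 2*b2 + b3)*(x - t)*x + (g1 + b4)*(x - t)*(x - 1))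
      + 2*(x - t)*z*((z - 1)*w + b2)) / (t*(t - 1))"
  unfolding Ham_y.simps Ham_eq_quotient
  by (rule DERIV_imp_deriv, rule DERIV_cdivide) 
    (rule derivative_eq_intros refl | simp)+

lemma Ham_w_eq:
  "Ham_w (Pt x y z w t (Params a0 a1 a2 g1 b2 b3 b4)) =
    (2*w*(z - t)*(z - 1)*z - ((a0 + g1 - 1)*(z - 1)*z + b3*(z - t)*z + b4*(z - t)*(z - 1))
      + 2*(x - t)*y*z*(z - 1)) / (t*(t - 1))"
  unfolding Ham_w.simps Ham_eq_quotient
  by (rule DERIV_imp_deriv, rule DERIV_cdivide) 
    (rule derivative_eq_intros refl | simp)+

lemma Ham_x_eq:
  "Ham_x (Pt x y z w t (Params a0 a1 a2 g1 b2 b3 b4)) =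
    (y^2*((x - 1)*x + (x - t)*x + (x - t)*(x - 1))
      - ((a0 - 1)*(2*x - 1) + (g1 + 2*b2 + b3)*(2*x - t) + (g1 + b4)*(2*x - t - 1))*y
      + a2*(a1 + a2) + 2*y*z*((z - 1)*w + b2)) / (t*(t - 1))"
  unfolding Ham_x.simps Ham_eq_quotient
  by (rule DERIV_imp_deriv, rule DERIV_cdivide) 
    (rule derivative_eq_intros refl | simp add: algebra_simps)+

lemma Ham_z_eq:
  "Ham_z (Pt x y z w t (Params a0 a1 a2 g1 b2 b3 b4)) =
    (w^2*((z - 1)*z + (z - t)*z + (z - t)*(z - 1))
      - ((a0 + g1 - 1)*(2*z - 1) + b3*(2*z - t) + b4*(2*z - t - 1))*w
      + b2*(a1 + 2*a2 + g1 + b2) + 2*(x - t)*y*((2*z - 1)*w + b2)) / (t*(t - 1))"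
  unfolding Ham_z.simps Ham_eq_quotient
  by (rule DERIV_imp_deriv, rule DERIV_cdivide) 
    (rule derivative_eq_intros refl | simp add: algebra_simps)+

definition system_at :: "(complex \<Rightarrow> complex pt) \<Rightarrow> complex \<Rightarrow> bool" where
  "system_at C s \<longleftrightarrow> pt_t (C s) \<noteq> 0 \<and> pt_t (C s) \<noteq> 1 \<and>
     (\<exists>t'. t' \<noteq> 0 \<and>
        ((\<lambda>s. pt_t (C s)) has_field_derivative t') (at s) \<and>
        ((\<lambda>s. pt_x (C s)) has_field_derivative t' * Ham_y (C s)) (at s) \<and>
        ((\<lambda>s. pt_y (C s)) has_field_derivative t' * (- Ham_x (C s))) (at s) \<and>
        ((\<lambda>s. pt_z (C s)) has_field_derivative t' * Ham_w (C s)) (at s) \<and>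
        ((\<lambda>s. pt_w (C s)) has_field_derivative t' * (- Ham_z (C s))) (at s))"

lemma solution_curve_iff:
  "solution_curve U C \<longleftrightarrow> open U \<and> (\<exists>\<theta>. normalised \<theta> \<and> (\<forall>s\<in>U. pt_params (C s) = \<theta>)) \<and>
     (\<forall>s\<in>U. system_at C s)"
  unfolding solution_curve_def system_at_def by blast

text \<open>\<open>transform_curve\<close> is known to agree with the explicit formulas only on
  \<open>U\<close>. Openness makes this enough for the derivatives at \<open>s\<close>.\<close>

lemma system_at_cong:
  assumes "open U" and "s \<in> U" and eq: "\<And>u. u \<in> U \<Longrightarrow> C u = C' u" and "system_at C s"
  shows "system_at C' s"
proof -
  have "((\<lambda>s. h (C' s)) has_field_derivative d) (at s)"
    if "((\<lambda>s. h (C s)) has_field_derivative d) (at s)" for h :: "complex pt \<Rightarrow> complex" and d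
    by (rule has_field_derivative_transform_within_open[OF that assms(1,2)]) (simp add: eq)
  note deriv = this
  show ?thesis
    using assms(4) unfolding system_at_def eq[OF assms(2), symmetric]
    by (elim conjE exE, intro conjI exI deriv)
qed

text \<open>The derivatives \<open>dX\<close> to \<open>dW\<close> stay open until the derivative
  rules produce them; the last four premises then compare them with the Hamiltonian vector field and
  are pure identities at \<open>s\<close>.\<close>

lemma system_atI:
  assumes "(T has_field_derivative t') (at s)" and "t' \<noteq> 0" and "T s \<noteq> 0" and "T s \<noteq> 1"
    and "(X has_field_derivative dX) (at s)" and "(Y has_field_derivative dY) (at s)"
    and "(Z has_field_derivative dZ) (at s)" and "(W has_field_derivative dW) (at s)"
    and "dX = t' * Ham_y (Pt (X s) (Y s) (Z s) (W s) (T s) \<theta>)"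
    and "dY = t' * (- Ham_x (Pt (X s) (Y s) (Z s) (W s) (T s) \<theta>))"
    and "dZ = t' * Ham_w (Pt (X s) (Y s) (Z s) (W s) (T s) \<theta>)"
    and "dW = t' * (- Ham_z (Pt (X s) (Y s) (Z s) (W s) (T s) \<theta>))"
  shows "system_at (\<lambda>u. Pt (X u) (Y u) (Z u) (W u) (T u) \<theta>) s"
  unfolding system_at_def pt.sel
  by (intro conjI exI[of _ t']) (use assms in simp_all)

text \<open>The case \<open>t' = 1\<close> of the system: functions of the independent variable
  itself, known only through their values and derivatives at the single point
  \<open>s\<close>.\<close>

locale solution_germ =
  fixes x y z w :: "complex \<Rightarrow> complex" and s a0 a1 a2 g1 b2 b3 b4 :: complex
  assumes norm: "normalised (Params a0 a1 a2 g1 b2 b3 b4)"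
    and s_neq: "s \<noteq> 0" "s \<noteq> 1"
    and dx: "(x has_field_derivative
      Ham_y (Pt (x s) (y s) (z s) (w s) s (Params a0 a1 a2 g1 b2 b3 b4))) (at s)"
    and dy: "(y has_field_derivative
      - Ham_x (Pt (x s) (y s) (z s) (w s) s (Params a0 a1 a2 g1 b2 b3 b4))) (at s)"
    and dz: "(z has_field_derivative
      Ham_w (Pt (x s) (y s) (z s) (w s) s (Params a0 a1 a2 g1 b2 b3 b4))) (at s)"
    and dw: "(w has_field_derivative
      - Ham_z (Pt (x s) (y s) (z s) (w s) s (Params a0 a1 a2 g1 b2 b3 b4))) (at s)"
begin

text \<open>As a rewrite rule this builds the normalisation into the identities to be checked, which
  afterwards involve independent parameters only.\<close>

lemma a0_eq: "a0 = 1 - a1 - 2 * a2 - 2 * g1 - 2 * b2 - b3 - b4"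
  using norm by (simp add: algebra_simps)

abbreviation point :: "complex \<Rightarrow> complex pt" where
  "point u \<equiv> Pt (x u) (y u) (z u) (w u) u (Params a0 a1 a2 g1 b2 b3 b4)"

end

text \<open>Separates three tasks: \<open>dom\<close> turns regularity into nonvanishing of
  denominators, \<open>ev\<close> identifies the transformed curve with the formulas
  \<open>F\<close> at complex points, and \<open>germ\<close> is the computation with the chain rule
  at one point.\<close>

lemma carries_systemI:
  fixes F :: "complex pt \<Rightarrow> complex pt" and G :: "ratfun pt"
  assumes G: "map_pt \<phi> generic = G"
    and dom: "\<And>P. normalised (pt_params P) \<Longrightarrow> pt_t P \<noteq> 0 \<Longrightarrow> pt_t P \<noteq> 1 \<Longrightarrow>
      (\<forall>f\<in>set_pt G. regular_at id P f) \<Longrightarrow> D P"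
    and ev: "\<And>P. normalised (pt_params P) \<Longrightarrow> D P \<Longrightarrow> rel_pt (evals id P) G (F P)"
    and par: "\<And>P Q. pt_params P = pt_params Q \<Longrightarrow> pt_params (F P) = pt_params (F Q)"
    and norm: "\<And>P. normalised (pt_params P) \<Longrightarrow> normalised (pt_params (F P))"
    and germ: "\<And>x y z w s a0 a1 a2 g1 b2 b3 b4. solution_germ x y z w s a0 a1 a2 g1 b2 b3 b4 \<Longrightarrow>
      D (Pt (x s) (y s) (z s) (w s) s (Params a0 a1 a2 g1 b2 b3 b4)) \<Longrightarrow>
      system_at (\<lambda>u. F (Pt (x u) (y u) (z u) (w u) u (Params a0 a1 a2 g1 b2 b3 b4))) s"
  shows "carries_system \<phi>"
  unfolding carries_system_def
proof (intro allI impI, elim conjE)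
  fix U C
  assume sol: "solution_curve U C" and t: "\<forall>s\<in>U. pt_t (C s) = s"
    and reg: "\<forall>s\<in>U. \<forall>f\<in>set_pt generic. regular_at id (C s) (\<phi> f)"
  from sol have U: "open U" unfolding solution_curve_iff by blast
  from sol obtain \<theta> where \<theta>: "normalised \<theta>" "\<And>s. s \<in> U \<Longrightarrow> pt_params (C s) = \<theta>"
    unfolding solution_curve_iff by blast
  have at: "system_at C s" if "s \<in> U" for s
    using sol that unfolding solution_curve_iff by blast
  have t_neq: "pt_t (C s) \<noteq> 0" "pt_t (C s) \<noteq> 1" if "s \<in> U" for s
    using at[OF that] unfolding system_at_def by simp_all
  obtain a0 a1 a2 g1 b2 b3 b4 where \<theta>_eq: "\<theta> = Params a0 a1 a2 g1 b2 b3 b4"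
    by (cases \<theta>)
  \<comment> \<open>Agrees with \<open>C\<close> on \<open>U\<close>, but has \<open>u\<close> and
    \<open>\<theta>\<close> literally as its last components, so that the explicit formulas can be
    differentiated in \<open>u\<close>.\<close>
  define P where "P u = Pt (pt_x (C u)) (pt_y (C u)) (pt_z (C u)) (pt_w (C u)) u \<theta>" for u
  have C: "C u = P u" if "u \<in> U" for u
    using that t \<theta>(2) by (simp add: P_def pt.expand)
  have D: "D (C s)" if "s \<in> U" for s
  proof (rule dom)
    show "\<forall>f\<in>set_pt G. regular_at id (C s) f"
      using reg that unfolding G[symmetric] by (simp add: pt.set_map)
    show "normalised (pt_params (C s))" using \<theta> that by simp
    show "pt_t (C s) \<noteq> 0" "pt_t (C s) \<noteq> 1"
      using t_neq[OF that] by simp_all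
  qed
  have F: "transform_curve \<phi> C s = F (P s)" if "s \<in> U" for s
  proof -
    have "rel_pt (evals id (C s)) G (F (C s))"
      using \<theta> that D[OF that] by (intro ev) auto
    then have "rel_pt (\<lambda>f r. rat_value id (C s) f = r) G (F (C s))"
      by (rule pt.rel_mono_strong) (rule complex_point.rat_value_eq)
    then have "rel_pt (=) (map_pt (rat_value id (C s)) G) (F (C s))"
      by (simp add: pt.rel_map)
    then have "map_pt (rat_value id (C s)) G = F (C s)"
      by (simp add: pt.rel_eq)
    then show ?thesis
      unfolding transform_curve_def G[symmetric] C[OF that, symmetric]
      by (simp add: pt.map_comp comp_def)
  qed
  show "solution_curve U (transform_curve \<phi> C)"
    unfolding solution_curve_iff
  proof (intro conjI ballI U)
    \<comment> \<open>By \<open>par\<close> the new parameters depend on \<open>\<theta>\<close>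
      alone, so a point with zero coordinates serves to name them.\<close>
    have "pt_params (F (P s)) = pt_params (F (Pt 0 0 0 0 0 \<theta>))" for s
      by (rule par) (simp add: P_def)
    moreover have "normalised (pt_params (F (Pt 0 0 0 0 0 \<theta>)))"
      using \<theta>(1) by (intro norm) simp
    ultimately show "\<exists>\<theta>. normalised \<theta> \<and> (\<forall>s\<in>U. pt_params (transform_curve \<phi> C s) = \<theta>)"
      using F by auto
  next
    fix s assume s: "s \<in> U"
    obtain t' where t': "((\<lambda>s. pt_t (C s)) has_field_derivative t') (at s)"
      and d: "((\<lambda>s. pt_x (C s)) has_field_derivative t' * Ham_y (C s)) (at s)"
      "((\<lambda>s. pt_y (C s)) has_field_derivative t' * (- Ham_x (C s))) (at s)"
      "((\<lambda>s. pt_z (C s)) has_field_derivative t' * Ham_w (C s)) (at s)"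
      "((\<lambda>s. pt_w (C s)) has_field_derivative t' * (- Ham_z (C s))) (at s)"
      using at[OF s] unfolding system_at_def by (elim conjE exE)
    \<comment> \<open>The \<open>t\<close>-component of \<open>C\<close> is the identity on the open
      set \<open>U\<close>, which forces \<open>t' = 1\<close>.\<close>
    have "((\<lambda>s. s) has_field_derivative t') (at s)"
      by (rule has_field_derivative_transform_within_open[OF t' U s]) (simp add: t)
    then have "t' = 1"
      by (rule DERIV_unique[OF _ DERIV_ident])
    then have "solution_germ (\<lambda>s. pt_x (C s)) (\<lambda>s. pt_y (C s)) (\<lambda>s. pt_z (C s)) (\<lambda>s. pt_w (C s)) s
        a0 a1 a2 g1 b2 b3 b4"
      using d \<theta>(1) t_neq[OF s] unfolding C[OF s]
      by unfold_locales (simp_all add: P_def \<theta>_eq)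
    moreover have "D (P s)"
      using D[OF s] by (simp only: C[OF s])
    ultimately have "system_at (\<lambda>u. F (P u)) s"
      unfolding P_def \<theta>_eq by (rule germ)
    then show "system_at (transform_curve \<phi> C) s"
      by (rule system_at_cong[OF U s, rotated]) (simp add: F)
  qed
qed

context solution_germ
begin

lemmas Ham_eqs = Ham_x_eq Ham_y_eq Ham_z_eq Ham_w_eq

lemma s_germ:
  assumes "i \<le> 6" and "s_dom i (point s)"
  shows "system_at (\<lambda>u. s_map i (point u)) s"
  using assms(1)
proof (cases i rule: less_7_cases)
  case 1
  \<comment> \<open>The map keeps \<open>t\<close>, so \<open>t'\<close> comes out as 1, and
    \<open>1 \<noteq> 0\<close> is the premise \<open>t' \<noteq> 0\<close> of
    \<open>system_atI\<close>.\<close>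
  have nz: "s \<noteq> 0" "s \<noteq> 1" "(1::complex) \<noteq> 0" "x s - s \<noteq> 0"
    using assms(2) s_neq unfolding 1 by auto
  show ?thesis
    unfolding 1 s_map_simps s0_map.simps
    \<comment> \<open>The disequalities are dropped before \<open>algebra\<close>, which would otherwise feed them into its
      Groebner basis computation and fail.\<close>
    by (rule system_atI, (rule nz dx dy dz dw derivative_intros)+)
      ((simp only: Ham_eqs a0_eq; insert nz; simp add: divide_simps power2_eq_square;
          (thin_tac "_ \<noteq> _")+; algebra)+)
next
  case 2
  have nz: "s \<noteq> 0" "s \<noteq> 1" "(1::complex) \<noteq> 0"
    using assms(2) s_neq unfolding 2 by auto
  show ?thesis
    unfolding 2 s_map_simps s1_map.simps
    by (rule system_atI, (rule nz dx dy dz dw derivative_intros)+)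
      ((simp only: Ham_eqs a0_eq; insert nz; simp add: divide_simps power2_eq_square;
          (thin_tac "_ \<noteq> _")+; algebra)+)
next
  case 3
  have nz: "s \<noteq> 0" "s \<noteq> 1" "(1::complex) \<noteq> 0" "y s \<noteq> 0"
    using assms(2) s_neq unfolding 3 by auto
  show ?thesis
    unfolding 3 s_map_simps s2_map.simps
    by (rule system_atI, (rule nz dx dy dz dw derivative_intros)+)
      ((simp only: Ham_eqs a0_eq; insert nz; simp add: divide_simps power2_eq_square;
          (thin_tac "_ \<noteq> _")+; algebra)+)
next
  case 4
  have nz: "s \<noteq> 0" "s \<noteq> 1" "(1::complex) \<noteq> 0" "x s - z s \<noteq> 0"
    using assms(2) s_neq unfolding 4 by auto
  show ?thesis
    unfolding 4 s_map_simps s3_map.simps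
    by (rule system_atI, (rule nz dx dy dz dw derivative_intros)+)
      ((simp only: Ham_eqs a0_eq; insert nz; simp add: divide_simps power2_eq_square;
          (thin_tac "_ \<noteq> _")+; algebra)+)
next
  case 5
  have nz: "s \<noteq> 0" "s \<noteq> 1" "(1::complex) \<noteq> 0" "w s \<noteq> 0"
    using assms(2) s_neq unfolding 5 by auto
  show ?thesis
    unfolding 5 s_map_simps s4_map.simps
    by (rule system_atI, (rule nz dx dy dz dw derivative_intros)+)
      ((simp only: Ham_eqs a0_eq; insert nz; simp add: divide_simps power2_eq_square;
          (thin_tac "_ \<noteq> _")+; algebra)+)
next
  case 6
  have nz: "s \<noteq> 0" "s \<noteq> 1" "(1::complex) \<noteq> 0" "z s - 1 \<noteq> 0"
    using assms(2) s_neq unfolding 6 by auto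
  show ?thesis
    unfolding 6 s_map_simps s5_map.simps
    by (rule system_atI, (rule nz dx dy dz dw derivative_intros)+)
      ((simp only: Ham_eqs a0_eq; insert nz; simp add: divide_simps power2_eq_square;
          (thin_tac "_ \<noteq> _")+; algebra)+)
next
  case 7
  have nz: "s \<noteq> 0" "s \<noteq> 1" "(1::complex) \<noteq> 0" "z s \<noteq> 0"
    using assms(2) s_neq unfolding 7 by auto
  show ?thesis
    unfolding 7 s_map_simps s6_map.simps
    by (rule system_atI, (rule nz dx dy dz dw derivative_intros)+)
      ((simp only: Ham_eqs a0_eq; insert nz; simp add: divide_simps power2_eq_square;
          (thin_tac "_ \<noteq> _")+; algebra)+)
qed

lemma pi_germ:
  assumes "j \<in> {1..4}" and "pi_dom j (point s)"
  shows "system_at (\<lambda>u. pi_map j (point u)) s"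
  using assms(1)
proof (cases j rule: one_to_4_cases)
  case 1
  have nz: "s \<noteq> 0" "s \<noteq> 1" "(1::complex) \<noteq> 0" "x s - s \<noteq> 0" "z s - s \<noteq> 0" "s * (s - 1) \<noteq> 0"
    using assms(2) s_neq unfolding 1 by auto
  show ?thesis
    unfolding 1 pi_map_simps pi1_map.simps
    by (rule system_atI, (rule nz dx dy dz dw derivative_intros)+)
      ((simp only: Ham_eqs a0_eq; insert nz; simp add: divide_simps power2_eq_square;
          (thin_tac "_ \<noteq> _")+; algebra)+)
next
  case 2
  have nz: "s \<noteq> 0" "s \<noteq> 1" "(1::complex) \<noteq> 0" "x s \<noteq> 0" "z s \<noteq> 0"
    using assms(2) s_neq unfolding 2 by auto
  show ?thesis
    unfolding 2 pi_map_simps pi2_map.simps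
    by (rule system_atI, (rule nz dx dy dz dw derivative_intros)+)
      ((simp only: Ham_eqs a0_eq; insert nz; simp add: divide_simps power2_eq_square;
          (thin_tac "_ \<noteq> _")+; algebra)+)
next
  case 3
  \<comment> \<open>Here the new independent variable is \<open>1 - t\<close>. The derivative rules
    return its derivative unsimplified as \<open>0 - 1\<close>, hence the form of the last
    fact.\<close>
  have nz: "s \<noteq> 0" "s \<noteq> 1" "(1::complex) \<noteq> 0" "1 - s \<noteq> 0" "1 - s \<noteq> 1" "0 - 1 \<noteq> (0::complex)"
    using assms(2) s_neq unfolding 3 by auto
  show ?thesis
    unfolding 3 pi_map_simps pi3_map.simps
    by (rule system_atI, (rule nz dx dy dz dw derivative_intros)+)
      ((simp only: Ham_eqs a0_eq; insert nz; simp add: divide_simps power2_eq_square;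
          (thin_tac "_ \<noteq> _")+; algebra)+)
next
  case 4
  have nz: "s \<noteq> 0" "s \<noteq> 1" "(1::complex) \<noteq> 0" "s - x s \<noteq> 0" "s - z s \<noteq> 0" "x s - s \<noteq> 0" "z s - s \<noteq> 0" "s * (s - 1) \<noteq> 0" "1 - s \<noteq> 0" "1 - s \<noteq> 1" "0 - 1 \<noteq> (0::complex)"
    using assms(2) s_neq unfolding 4 by auto
  show ?thesis
    unfolding 4 pi_map_simps pi4_map.simps
    by (rule system_atI, (rule nz dx dy dz dw derivative_intros)+)
      ((simp only: Ham_eqs a0_eq; insert nz; simp add: divide_simps power2_eq_square;
          (thin_tac "_ \<noteq> _")+; algebra)+)
qed

end


section \<open>Regularity of the transformed coordinates\<close>

text \<open>
  If \<open>d\<close> vanishes along a curve through a point and \<open>n\<close> does not, then \<open>n / d\<close> is not regular at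
  the point even if \<open>n\<close> happens to vanish there: the denominator of a representation that is valid
  at the point would also be valid nearby.
\<close>

lemma not_regular_at_quotient:
  assumes f: "f * d = n"
    and cont: "\<And>v. isCont (\<lambda>e. coord_of (R e) v) 0"
    and d: "\<And>e. evals id (R e) d 0" and n: "\<And>e. evals id (R e) n (N e)"
    and N: "\<exists>\<^sub>F e in at (0::complex). N e \<noteq> 0"
  shows "\<not> regular_at id (R 0) f"
proof
  assume "regular_at id (R 0) f"
  then obtain p q where fr: "f = Fract p q" and q: "poly_value id (R 0) q \<noteq> 0"
    unfolding regular_at_def by blast
  have "isCont (\<lambda>e. poly_value id (R e) q) 0"
    unfolding poly_value_def by (intro continuous_intros cont)
  then have "((\<lambda>e. poly_value id (R e) q) \<longlongrightarrow> poly_value id (R 0) q) (at 0)"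
    by (simp add: isCont_def)
  then have "\<forall>\<^sub>F e in at 0. poly_value id (R e) q \<noteq> 0"
    by (rule tendsto_imp_eventually_ne) (rule q)
  from frequently_ex[OF frequently_eventually_conj[OF N this]]
  obtain e where e: "N e \<noteq> 0" "poly_value id (R e) q \<noteq> 0"
    by blast
  have "evals id (R e) n (poly_value id (R e) p / poly_value id (R e) q * 0)"
    unfolding f[symmetric] fr
    by (intro complex_point.evals_mult complex_point.evals_Fract d e(2))
  then show False
    using complex_point.evals_unique[OF n] e(1) by auto
qed

lemma frequently_at_0_neq: "\<exists>\<^sub>F e in at 0. e - c \<noteq> (0::complex)"
  using eventually_neq_at_within[of c 0 UNIV] by (intro eventually_frequently) simp_all

lemma evals_eqI: "evals \<kappa> P f r \<Longrightarrow> r = r' \<Longrightarrow> evals \<kappa> P f r'"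
  by simp

text \<open>Where a denominator vanishes, the numerator is plus or minus the parameter of the
  reflection, and this may be zero at the given point. The nearby points are therefore obtained by
  moving that parameter by \<open>e\<close>, with the sign that makes the numerator \<open>e\<close>
  minus a constant.\<close>

lemma s_dom_of_regular:
  assumes "i \<le> 6" and "normalised (pt_params P)"
    and reg: "\<forall>f\<in>set_pt (s_map i generic). regular_at id P f"
  shows "s_dom i P"
proof -
  obtain x y z w t a0 a1 a2 g1 b2 b3 b4
    where P: "P = Pt x y z w t (Params a0 a1 a2 g1 b2 b3 b4)"
    by (cases P rule: Ham.cases)
  have a0: "a0 = 1 - a1 - 2 * a2 - 2 * g1 - 2 * b2 - b3 - b4"
    using assms(2) by (simp add: P algebra_simps)
  show ?thesis
    using assms(1)
  proof (cases i rule: less_7_cases)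
    case 1
    have "x \<noteq> t"
    proof
      assume eq: "x = t"
      let ?A0 = "1 - gen Ca1 - 2 * gen Ca2 - 2 * gen Cg1 - 2 * gen Cb2 - gen Cb3 - gen Cb4"
      \<comment> \<open>\<open>\<alpha>\<^sub>0\<close> cannot be moved directly, since evaluation
        does not read the stored \<open>a0\<close>. Raising \<open>a1\<close> by \<open>e\<close>
        lowers the value of \<open>?A0\<close> by \<open>e\<close>.\<close>
      let ?R = "\<lambda>e. Pt x y z w t (Params a0 (a1 + e) a2 g1 b2 b3 b4)"
      have "\<not> regular_at id (?R 0) (gen Cy - ?A0 / (gen Cx - gen Ct))"
      proof (rule not_regular_at_quotient)
        show "(gen Cy - ?A0 / (gen Cx - gen Ct)) * (gen Cx - gen Ct) =
            gen Cy * (gen Cx - gen Ct) - ?A0"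
          by (simp add: field_simps gen_nonzero gen_diff_nonzero gen_neq_1)
        show "isCont (\<lambda>e. coord_of (?R e) v) 0" for v
          by (cases v) simp_all
        show "evals id (?R e) (gen Cx - gen Ct) 0" for e
          by (rule evals_eqI, (rule complex_point.evals_intros)+) (simp add: eq)
        show "evals id (?R e) (gen Cy * (gen Cx - gen Ct) - ?A0) (e - a0)" for e
          by (rule evals_eqI, (rule complex_point.evals_intros)+)
            (use a0 in \<open>simp add: eq algebra_simps\<close>)
        show "\<exists>\<^sub>F e in at (0 :: complex). e - a0 \<noteq> 0"
          by (rule frequently_at_0_neq)
      qed
      then show False
        using reg by (simp add: P 1 generic_def)
    qed
    then show ?thesis by (simp add: P 1)
  next
    case 2
    then show ?thesis by (simp add: P)
  next
    case 3
    have "y \<noteq> 0"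
    proof
      assume eq: "y = 0"
      let ?R = "\<lambda>e. Pt x y z w t (Params a0 a1 (a2 + e) g1 b2 b3 b4)"
      have "\<not> regular_at id (?R 0) (gen Cx + gen Ca2 / gen Cy)"
      proof (rule not_regular_at_quotient)
        show "(gen Cx + gen Ca2 / gen Cy) * (gen Cy) = gen Cx * gen Cy + gen Ca2"
          by (simp add: field_simps gen_nonzero gen_diff_nonzero gen_neq_1)
        show "isCont (\<lambda>e. coord_of (?R e) v) 0" for v
          by (cases v) simp_all
        show "evals id (?R e) (gen Cy) 0" for e
          by (rule evals_eqI, (rule complex_point.evals_intros)+) (simp add: eq)
        show "evals id (?R e) (gen Cx * gen Cy + gen Ca2) (e - (- a2))" for e
          by (rule evals_eqI, (rule complex_point.evals_intros)+)
            (use a0 in \<open>simp add: eq algebra_simps\<close>)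
        show "\<exists>\<^sub>F e in at (0 :: complex). e - (- a2) \<noteq> 0"
          by (rule frequently_at_0_neq)
      qed
      then show False
        using reg by (simp add: P 3 generic_def)
    qed
    then show ?thesis by (simp add: P 3)
  next
    case 4
    have "x \<noteq> z"
    proof
      assume eq: "x = z"
      let ?R = "\<lambda>e. Pt x y z w t (Params a0 a1 a2 (g1 - e) b2 b3 b4)"
      have "\<not> regular_at id (?R 0) (gen Cy - gen Cg1 / (gen Cx - gen Cz))"
      proof (rule not_regular_at_quotient)
        show "(gen Cy - gen Cg1 / (gen Cx - gen Cz)) * (gen Cx - gen Cz) = gen Cy * (gen Cx - gen Cz) - gen Cg1"
          by (simp add: field_simps gen_nonzero gen_diff_nonzero gen_neq_1)
        show "isCont (\<lambda>e. coord_of (?R e) v) 0" for v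
          by (cases v) simp_all
        show "evals id (?R e) (gen Cx - gen Cz) 0" for e
          by (rule evals_eqI, (rule complex_point.evals_intros)+) (simp add: eq)
        show "evals id (?R e) (gen Cy * (gen Cx - gen Cz) - gen Cg1) (e - g1)" for e
          by (rule evals_eqI, (rule complex_point.evals_intros)+)
            (use a0 in \<open>simp add: eq algebra_simps\<close>)
        show "\<exists>\<^sub>F e in at (0 :: complex). e - g1 \<noteq> 0"
          by (rule frequently_at_0_neq)
      qed
      then show False
        using reg by (simp add: P 4 generic_def)
    qed
    then show ?thesis by (simp add: P 4)
  next
    case 5
    have "w \<noteq> 0"
    proof
      assume eq: "w = 0"
      let ?R = "\<lambda>e. Pt x y z w t (Params a0 a1 a2 g1 (b2 + e) b3 b4)"
      have "\<not> regular_at id (?R 0) (gen Cz + gen Cb2 / gen Cw)"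
      proof (rule not_regular_at_quotient)
        show "(gen Cz + gen Cb2 / gen Cw) * (gen Cw) = gen Cz * gen Cw + gen Cb2"
          by (simp add: field_simps gen_nonzero gen_diff_nonzero gen_neq_1)
        show "isCont (\<lambda>e. coord_of (?R e) v) 0" for v
          by (cases v) simp_all
        show "evals id (?R e) (gen Cw) 0" for e
          by (rule evals_eqI, (rule complex_point.evals_intros)+) (simp add: eq)
        show "evals id (?R e) (gen Cz * gen Cw + gen Cb2) (e - (- b2))" for e
          by (rule evals_eqI, (rule complex_point.evals_intros)+)
            (use a0 in \<open>simp add: eq algebra_simps\<close>)
        show "\<exists>\<^sub>F e in at (0 :: complex). e - (- b2) \<noteq> 0"
          by (rule frequently_at_0_neq)
      qed
      then show False
        using reg by (simp add: P 5 generic_def)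
    qed
    then show ?thesis by (simp add: P 5)
  next
    case 6
    have "z \<noteq> 1"
    proof
      assume eq: "z = 1"
      let ?R = "\<lambda>e. Pt x y z w t (Params a0 a1 a2 g1 b2 (b3 - e) b4)"
      have "\<not> regular_at id (?R 0) (gen Cw - gen Cb3 / (gen Cz - 1))"
      proof (rule not_regular_at_quotient)
        show "(gen Cw - gen Cb3 / (gen Cz - 1)) * (gen Cz - 1) = gen Cw * (gen Cz - 1) - gen Cb3"
          by (simp add: field_simps gen_nonzero gen_diff_nonzero gen_neq_1)
        show "isCont (\<lambda>e. coord_of (?R e) v) 0" for v
          by (cases v) simp_all
        show "evals id (?R e) (gen Cz - 1) 0" for e
          by (rule evals_eqI, (rule complex_point.evals_intros)+) (simp add: eq)
        show "evals id (?R e) (gen Cw * (gen Cz - 1) - gen Cb3) (e - b3)" for e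
          by (rule evals_eqI, (rule complex_point.evals_intros)+)
            (use a0 in \<open>simp add: eq algebra_simps\<close>)
        show "\<exists>\<^sub>F e in at (0 :: complex). e - b3 \<noteq> 0"
          by (rule frequently_at_0_neq)
      qed
      then show False
        using reg by (simp add: P 6 generic_def)
    qed
    then show ?thesis by (simp add: P 6)
  next
    case 7
    have "z \<noteq> 0"
    proof
      assume eq: "z = 0"
      let ?R = "\<lambda>e. Pt x y z w t (Params a0 a1 a2 g1 b2 b3 (b4 - e))"
      have "\<not> regular_at id (?R 0) (gen Cw - gen Cb4 / gen Cz)"
      proof (rule not_regular_at_quotient)
        show "(gen Cw - gen Cb4 / gen Cz) * (gen Cz) = gen Cw * gen Cz - gen Cb4"
          by (simp add: field_simps gen_nonzero gen_diff_nonzero gen_neq_1)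
        show "isCont (\<lambda>e. coord_of (?R e) v) 0" for v
          by (cases v) simp_all
        show "evals id (?R e) (gen Cz) 0" for e
          by (rule evals_eqI, (rule complex_point.evals_intros)+) (simp add: eq)
        show "evals id (?R e) (gen Cw * gen Cz - gen Cb4) (e - b4)" for e
          by (rule evals_eqI, (rule complex_point.evals_intros)+)
            (use a0 in \<open>simp add: eq algebra_simps\<close>)
        show "\<exists>\<^sub>F e in at (0 :: complex). e - b4 \<noteq> 0"
          by (rule frequently_at_0_neq)
      qed
      then show False
        using reg by (simp add: P 7 generic_def)
    qed
    then show ?thesis by (simp add: P 7)
  qed
qed

text \<open>No parameter has to be moved here, so the family of points is constant: where a
  denominator of the transformed \<open>x\<close> or \<open>z\<close> vanishes, its numerator equals
  \<open>t * (t - 1)\<close> or \<open>t\<close>, which is nonzero by assumption. The denominators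
  of the transformed \<open>y\<close> and \<open>w\<close> involve \<open>t\<close> alone.\<close>

lemma pi_dom_of_regular:
  assumes "j \<in> {1..4}" and "normalised (pt_params P)" and t: "pt_t P \<noteq> 0" "pt_t P \<noteq> 1"
    and reg: "\<forall>f\<in>set_pt (pi_map j generic). regular_at id P f"
  shows "pi_dom j P"
proof -
  obtain x y z w t a0 a1 a2 g1 b2 b3 b4
    where P: "P = Pt x y z w t (Params a0 a1 a2 g1 b2 b3 b4)"
    by (cases P rule: Ham.cases)
  have a0: "a0 = 1 - a1 - 2 * a2 - 2 * g1 - 2 * b2 - b3 - b4"
    using assms(2) by (simp add: P algebra_simps)
  show ?thesis
    using assms(1)
  proof (cases j rule: one_to_4_cases)
    case 1
    let ?R = "\<lambda>e :: complex. P"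
    have "x \<noteq> t"
    proof
      assume eq: "x = t"
      have "\<not> regular_at id (?R 0) ((gen Ct * (gen Ct - 1) + gen Ct * (gen Cx - gen Ct)) / (gen Cx - gen Ct))"
      proof (rule not_regular_at_quotient)
        show "((gen Ct * (gen Ct - 1) + gen Ct * (gen Cx - gen Ct)) / (gen Cx - gen Ct)) * (gen Cx - gen Ct) = gen Ct * (gen Ct - 1) + gen Ct * (gen Cx - gen Ct)"
          by (simp add: field_simps gen_nonzero gen_diff_nonzero gen_neq_1)
        show "isCont (\<lambda>e. coord_of (?R e) v) 0" for v
          by (cases v) simp_all
        show "evals id (?R e) (gen Cx - gen Ct) 0" for e
          by (rule evals_eqI, (rule complex_point.evals_intros)+) (simp add: eq P)
        show "evals id (?R e) (gen Ct * (gen Ct - 1) + gen Ct * (gen Cx - gen Ct)) (t * (t - 1))" for e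
          by (rule evals_eqI, (rule complex_point.evals_intros)+)
            (use a0 in \<open>simp add: eq P algebra_simps\<close>)
        show "\<exists>\<^sub>F e in at (0 :: complex). t * (t - 1) \<noteq> 0"
          using t by (simp add: P)
      qed
      then show False
        using reg by (simp add: 1 generic_def)
    qed
    moreover
    have "z \<noteq> t"
    proof
      assume eq: "z = t"
      have "\<not> regular_at id (?R 0) ((gen Ct * (gen Ct - 1) + gen Ct * (gen Cz - gen Ct)) / (gen Cz - gen Ct))"
      proof (rule not_regular_at_quotient)
        show "((gen Ct * (gen Ct - 1) + gen Ct * (gen Cz - gen Ct)) / (gen Cz - gen Ct)) * (gen Cz - gen Ct) = gen Ct * (gen Ct - 1) + gen Ct * (gen Cz - gen Ct)"
          by (simp add: field_simps gen_nonzero gen_diff_nonzero gen_neq_1)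
        show "isCont (\<lambda>e. coord_of (?R e) v) 0" for v
          by (cases v) simp_all
        show "evals id (?R e) (gen Cz - gen Ct) 0" for e
          by (rule evals_eqI, (rule complex_point.evals_intros)+) (simp add: eq P)
        show "evals id (?R e) (gen Ct * (gen Ct - 1) + gen Ct * (gen Cz - gen Ct)) (t * (t - 1))" for e
          by (rule evals_eqI, (rule complex_point.evals_intros)+)
            (use a0 in \<open>simp add: eq P algebra_simps\<close>)
        show "\<exists>\<^sub>F e in at (0 :: complex). t * (t - 1) \<noteq> 0"
          using t by (simp add: P)
      qed
      then show False
        using reg by (simp add: 1 generic_def)
    qed
    ultimately show ?thesis using t by (simp add: P 1)
  next
    case 2
    let ?R = "\<lambda>e :: complex. P"
    have "x \<noteq> 0"
    proof
      assume eq: "x = 0"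
      have "\<not> regular_at id (?R 0) (gen Ct / gen Cx)"
      proof (rule not_regular_at_quotient)
        show "(gen Ct / gen Cx) * (gen Cx) = gen Ct"
          by (simp add: field_simps gen_nonzero gen_diff_nonzero gen_neq_1)
        show "isCont (\<lambda>e. coord_of (?R e) v) 0" for v
          by (cases v) simp_all
        show "evals id (?R e) (gen Cx) 0" for e
          by (rule evals_eqI, (rule complex_point.evals_intros)+) (simp add: eq P)
        show "evals id (?R e) (gen Ct) (t)" for e
          by (rule evals_eqI, (rule complex_point.evals_intros)+)
            (use a0 in \<open>simp add: eq P algebra_simps\<close>)
        show "\<exists>\<^sub>F e in at (0 :: complex). t \<noteq> 0"
          using t by (simp add: P)
      qed
      then show False
        using reg by (simp add: 2 generic_def)
    qed
    moreover
    have "z \<noteq> 0"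
    proof
      assume eq: "z = 0"
      have "\<not> regular_at id (?R 0) (gen Ct / gen Cz)"
      proof (rule not_regular_at_quotient)
        show "(gen Ct / gen Cz) * (gen Cz) = gen Ct"
          by (simp add: field_simps gen_nonzero gen_diff_nonzero gen_neq_1)
        show "isCont (\<lambda>e. coord_of (?R e) v) 0" for v
          by (cases v) simp_all
        show "evals id (?R e) (gen Cz) 0" for e
          by (rule evals_eqI, (rule complex_point.evals_intros)+) (simp add: eq P)
        show "evals id (?R e) (gen Ct) (t)" for e
          by (rule evals_eqI, (rule complex_point.evals_intros)+)
            (use a0 in \<open>simp add: eq P algebra_simps\<close>)
        show "\<exists>\<^sub>F e in at (0 :: complex). t \<noteq> 0"
          using t by (simp add: P)
      qed
      then show False
        using reg by (simp add: 2 generic_def)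
    qed
    ultimately show ?thesis using t by (simp add: P 2)
  next
    case 3
    then show ?thesis by (simp add: P)
  next
    case 4
    let ?R = "\<lambda>e :: complex. P"
    have "x \<noteq> t"
    proof
      assume eq: "x = t"
      have "\<not> regular_at id (?R 0) ((gen Ct - 1) * gen Cx / (gen Ct - gen Cx))"
      proof (rule not_regular_at_quotient)
        show "((gen Ct - 1) * gen Cx / (gen Ct - gen Cx)) * (gen Ct - gen Cx) = (gen Ct - 1) * gen Cx"
          by (simp add: field_simps gen_nonzero gen_diff_nonzero gen_neq_1)
        show "isCont (\<lambda>e. coord_of (?R e) v) 0" for v
          by (cases v) simp_all
        show "evals id (?R e) (gen Ct - gen Cx) 0" for e
          by (rule evals_eqI, (rule complex_point.evals_intros)+) (simp add: eq P)
        show "evals id (?R e) ((gen Ct - 1) * gen Cx) ((t - 1) * t)" for e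
          by (rule evals_eqI, (rule complex_point.evals_intros)+)
            (use a0 in \<open>simp add: eq P algebra_simps\<close>)
        show "\<exists>\<^sub>F e in at (0 :: complex). (t - 1) * t \<noteq> 0"
          using t by (simp add: P)
      qed
      then show False
        using reg by (simp add: 4 generic_def)
    qed
    moreover
    have "z \<noteq> t"
    proof
      assume eq: "z = t"
      have "\<not> regular_at id (?R 0) ((gen Ct - 1) * gen Cz / (gen Ct - gen Cz))"
      proof (rule not_regular_at_quotient)
        show "((gen Ct - 1) * gen Cz / (gen Ct - gen Cz)) * (gen Ct - gen Cz) = (gen Ct - 1) * gen Cz"
          by (simp add: field_simps gen_nonzero gen_diff_nonzero gen_neq_1)
        show "isCont (\<lambda>e. coord_of (?R e) v) 0" for v
          by (cases v) simp_all
        show "evals id (?R e) (gen Ct - gen Cz) 0" for e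
          by (rule evals_eqI, (rule complex_point.evals_intros)+) (simp add: eq P)
        show "evals id (?R e) ((gen Ct - 1) * gen Cz) ((t - 1) * t)" for e
          by (rule evals_eqI, (rule complex_point.evals_intros)+)
            (use a0 in \<open>simp add: eq P algebra_simps\<close>)
        show "\<exists>\<^sub>F e in at (0 :: complex). (t - 1) * t \<noteq> 0"
          using t by (simp add: P)
      qed
      then show False
        using reg by (simp add: 4 generic_def)
    qed
    ultimately show ?thesis using t by (simp add: P 4)
  qed
qed

section \<open>The generators as Baecklund transformations\<close>

lemma baecklund_s_aut:
  assumes "i \<le> 6"
  shows "baecklund (s_aut i)"
proof -
  note props = s_aut_properties[OF assms]
  interpret field_aut "s_aut i" by standard (rule props(1))
  have "s_aut i ` param_field = param_field"
    by (rule param_field_image[OF props(2)])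
      (simp only: props(3) set_params_s_map[OF assms set_params_generic])
  moreover have "carries_system (s_aut i)"
  proof (rule carries_systemI[where F = "s_map i" and D = "s_dom i", OF props(3)])
    show "pt_params (s_map i P) = pt_params (s_map i Q)" if "pt_params P = pt_params Q"
      for P Q :: "complex pt"
      by (rule less_7_cases[OF assms]; cases P rule: Ham.cases; cases Q rule: Ham.cases; insert that)
        simp_all
  qed (simp_all only: s_dom_of_regular[OF assms] normalised_s_map[OF assms]
      solution_germ.s_germ[OF _ assms]
      complex_point.evals_s_map[OF assms complex_point.evals_generic])
  ultimately show ?thesis
    unfolding baecklund_def using props(1) by blast
qed

lemma baecklund_pi_aut:
  assumes "j \<in> {1..4}"
  shows "baecklund (pi_aut j)"
proof -
  note props = pi_aut_properties[OF assms]
  interpret field_aut "pi_aut j" by standard (rule props(1))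
  have "pi_aut j ` param_field = param_field"
    by (rule param_field_image[OF props(2)])
      (simp only: props(3) set_params_pi_map[OF assms set_params_generic])
  moreover have "carries_system (pi_aut j)"
  proof (rule carries_systemI[where F = "pi_map j" and D = "pi_dom j", OF props(3)])
    show "pt_params (pi_map j P) = pt_params (pi_map j Q)" if "pt_params P = pt_params Q"
      for P Q :: "complex pt"
      by (rule one_to_4_cases[OF assms]; cases P rule: Ham.cases; cases Q rule: Ham.cases; insert that)
        simp_all
  qed (simp_all only: not_False_eq_True pi_dom_of_regular[OF assms] normalised_pi_map[OF assms]
      solution_germ.pi_germ[OF _ assms]
      complex_point.evals_pi_map[OF assms complex_point.evals_generic])
  ultimately show ?thesis
    unfolding baecklund_def using props(1) by blast
qed

theorem theorem2p3:
  shows "(\<forall>i\<le>6. map_pt (s_aut i) generic = s_map i generic \<and> baecklund (s_aut i)) \<and>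
    (\<forall>j\<in>{1..4}. map_pt (pi_aut j) generic = pi_map j generic \<and> baecklund (pi_aut j)) \<and>
    (\<forall>i\<le>6. s_aut i \<circ> s_aut i = id) \<and>
    (\<forall>i\<le>6. \<forall>j\<le>6. i \<noteq> j \<longrightarrow> (s_aut i \<circ> s_aut j) ^^ D6_m i j = id) \<and>
    (\<forall>j\<in>{1..4}. pi_aut j \<circ> pi_aut j = id) \<and>
    (\<forall>j\<in>{1..4}. \<forall>i\<le>6. pi_aut j \<circ> s_aut i \<circ> inv (pi_aut j) = s_aut (D6_sigma j i))"
  by (intro conjI allI ballI impI s_aut_properties pi_aut_properties baecklund_s_aut
      baecklund_pi_aut s_aut_order pi_aut_conjugation)

end
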